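(* Let $\mathcal{T}_h$ be such that $$\|\nabla\boldsymbol{\mathcal{I}}_h[\boldsymbol w_h/|\boldsymbol w_h|]\|\le\|\nabla\boldsymbol w_h\|\quad\text{for all }\boldsymbol w_h\in\mathcal{S}^1(\mathcal{T}_h)^3\text{ with }|\boldsymbol w_h(\boldsymbol z)|\ge 1\text{ for all }\boldsymbol z\in\mathcal{N}_h .$$ For input $\boldsymbol m_h^0\in\boldsymbol{\mathcal{M}}_h$, let $\{(\boldsymbol v_h^\ell,\boldsymbol m_h^{\ell+1})\}_{\ell=0}^{L-1}$ be the output of the algorithm PC1+IMEX (defined in the context). Then, for all $J=0,\dots,L-1$, there holds the stability estimate $$\begin{aligned}&\frac{\ell_{\mathrm{ex}}^2}{2}\|\nabla\boldsymbol m_h^J\|^2+\alpha k\sum_{\ell=0}^{J-1}\|\boldsymbol v_h^\ell\|^2+\ell_{\mathrm{ex}}^2(\theta-1/2)k^2\sum_{\ell=0}^{J-1}\|\nabla\boldsymbol v_h^\ell\|^2\\&\qquad\le\frac{\ell_{\mathrm{ex}}^2}{2}\|\nabla\boldsymbol m_h^0\|^2+k\sum_{\ell=0}^{J-1}\langle\boldsymbol v_h^\ell,\boldsymbol\pi_h(\boldsymbol m_h^\ell)+\boldsymbol f^\ell\rangle .\end{aligned}$$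
   Context: **Setting.** $\Omega\subset\mathbb{R}^3$ is a bounded Lipschitz domain with a regular (conforming) tetrahedral triangulation $\mathcal{T}_h$ of mesh size $h>0$; $\mathcal{N}_h$ is the set of vertices of $\mathcal{T}_h$. $T>0$, $L\in\mathbb{N}$, $k:=T/L>0$ is the uniform time-step size, $t_\ell:=\ell k$. $\alpha\ge 0$ (damping), $\ell_{\mathrm{ex}}>0$ (exchange length), $\theta\in[0,1]$ are constants. $\boldsymbol f\in C^1([0,T];L^2(\Omega;\mathbb{R}^3))$ is an applied field, $\boldsymbol f^\ell:=\boldsymbol f(t_\ell)$. $\boldsymbol\pi_h:L^2(\Omega;\mathbb{R}^3)\to L^2(\Omega;\mathbb{R}^3)$ is a given operator (a numerical approximation of the linear, continuous, self-adjoint operator $\boldsymbol\pi:L^2(\Omega;\mathbb{R}^3)\to L^2(\Omega;\mathbb{R}^3)$ collecting the lower-order effective field contributions). $\times$ is the cross product and $\cdot$ the scalar product in $\mathbb{R}^3$, $|\cdot|$ the Euclidean norm, $\mathbb{S}^2$ the unit sphere in $\mathbb{R}^3$. $\langle\cdot,\cdot\rangle$ and $\|\cdot\|$ are the $L^2(\Omega)$-scalar product and norm (for vector- or matrix-valued functions). Empty sums are $0$. **Discrete spaces.** $\mathcal{S}^1(\mathcal{T}_h)$ is the space of $\mathcal{T}_h$-piecewise linear, globally continuous functions $\overline\Omega\to\mathbb{R}$, with nodal basis $\{\phi_{\boldsymbol z}\}_{\boldsymbol z\in\mathcal{N}_h}$, $\phi_{\boldsymbol z}(\boldsymbol z')=\delta_{\boldsymbol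 z,\boldsymbol z'}$. Set $$\boldsymbol{\mathcal{M}}_h:=\{\boldsymbol m_h\in\mathcal{S}^1(\mathcal{T}_h)^3:\ |\boldsymbol m_h(\boldsymbol z)|=1\ \text{for all }\boldsymbol z\in\mathcal{N}_h\}.$$ $\boldsymbol{\mathcal{I}}_h$ is the vector-valued nodal interpolant; for $\boldsymbol w_h\in\mathcal{S}^1(\mathcal{T}_h)^3$ nonvanishing at all vertices, $\boldsymbol{\mathcal{I}}_h[\boldsymbol w_h/|\boldsymbol w_h|]:=\sum_{\boldsymbol z\in\mathcal{N}_h}\frac{\boldsymbol w_h(\boldsymbol z)}{|\boldsymbol w_h(\boldsymbol z)|}\phi_{\boldsymbol z}$. **Mass-lumped product.** For continuous $\boldsymbol u,\boldsymbol w:\overline\Omega\to\mathbb{R}^3$, $$\langle\boldsymbol u,\boldsymbol w\rangle_h:=\sum_{\boldsymbol z\in\mathcal{N}_h}\beta_{\boldsymbol z}\,\boldsymbol u(\boldsymbol z)\cdot\boldsymbol w(\boldsymbol z),\qquad \beta_{\boldsymbol z}:=\int_\Omega\phi_{\boldsymbol z}\,d\boldsymbol x>0$$ (equivalently, the integral over $\Omega$ of the nodal interpolant of $\boldsymbol u\cdot\boldsymbol w$). **Discrete Laplacian.** For $\boldsymbol w\in H^1(\Omega;\mathbb{R}^3)$, $\boldsymbol\Delta_h\boldsymbol w\in\mathcal{S}^1(\mathcal{T}_h)^3$ is the unique function with $-\langle\boldsymbol\Delta_h\boldsymbol w,\boldsymbol w_h\rangle_h=\langle\nabla\boldsymbol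 w,\nabla\boldsymbol w_h\rangle$ for all $\boldsymbol w_h\in\mathcal{S}^1(\mathcal{T}_h)^3$. **Mapping $\mathbb{P}_h$.** For $\boldsymbol w\in L^2(\Omega;\mathbb{R}^3)$, $\mathbb{P}_h\boldsymbol w\in\mathcal{S}^1(\mathcal{T}_h)^3$ is the unique function with $\langle\mathbb{P}_h\boldsymbol w,\boldsymbol w_h\rangle_h=\langle\boldsymbol w,\boldsymbol w_h\rangle$ for all $\boldsymbol w_h\in\mathcal{S}^1(\mathcal{T}_h)^3$. **Algorithm PC1+IMEX.** Input $\boldsymbol m_h^0\in\boldsymbol{\mathcal{M}}_h$. For $\ell=0,\dots,L-1$: (i) Compute $\mathbb{P}_h(\boldsymbol\pi_h(\boldsymbol m_h^\ell))\in\mathcal{S}^1(\mathcal{T}_h)^3$. (ii) Compute $\boldsymbol v_h^\ell\in\mathcal{S}^1(\mathcal{T}_h)^3$ such that, for all $\boldsymbol w_h\in\mathcal{S}^1(\mathcal{T}_h)^3$, $$\begin{aligned}(1+\alpha^2)\langle\boldsymbol v_h^\ell,\boldsymbol w_h\rangle_h&=-\langle\boldsymbol m_h^\ell\times[\ell_{\mathrm{ex}}^2\boldsymbol\Delta_h(\boldsymbol m_h^\ell+\theta k\boldsymbol v_h^\ell)+\mathbb{P}_h(\boldsymbol\pi_h(\boldsymbol m_h^\ell)+\boldsymbol f^\ell)],\boldsymbol w_h\rangle_h\\&\quad-\alpha\langle\boldsymbol m_h^\ell\times(\boldsymbol m_h^\ell\times[\ell_{\mathrm{ex}}^2\boldsymbol\Delta_h(\boldsymbol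 m_h^\ell+\theta k\boldsymbol v_h^\ell)+\mathbb{P}_h(\boldsymbol\pi_h(\boldsymbol m_h^\ell)+\boldsymbol f^\ell)]),\boldsymbol w_h\rangle_h.\end{aligned}$$ (iii) Define $\boldsymbol m_h^{\ell+1}\in\boldsymbol{\mathcal{M}}_h$ by $$\boldsymbol m_h^{\ell+1}(\boldsymbol z):=\frac{\boldsymbol m_h^\ell(\boldsymbol z)+k\boldsymbol v_h^\ell(\boldsymbol z)}{|\boldsymbol m_h^\ell(\boldsymbol z)+k\boldsymbol v_h^\ell(\boldsymbol z)|}\in\mathbb{S}^2\quad\text{for all }\boldsymbol z\in\mathcal{N}_h.$$ *)

theory Defs
  imports "HOL-Analysis.Analysis"
begin

unbundle cross3_syntax

section \<open>Bounded Lipschitz domains\<close>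

text \<open>
  Near every boundary point the set is, in suitable Cartesian coordinates, the strict
  epigraph of a Lipschitz function.
\<close>

definition bounded_lipschitz_domain :: "(real^3) set \<Rightarrow> bool" where
  "bounded_lipschitz_domain \<Omega> \<longleftrightarrow>
     open \<Omega> \<and> connected \<Omega> \<and> \<Omega> \<noteq> {} \<and> bounded \<Omega> \<and>
     (\<forall>p\<in>frontier \<Omega>. \<exists>U Q \<gamma> C.
        open U \<and> p \<in> U \<and> orthogonal_transformation (Q :: real^3 \<Rightarrow> real^3) \<and>
        C-lipschitz_on UNIV (\<gamma> :: real^2 \<Rightarrow> real) \<and>
        (\<forall>x\<in>U. x \<in> \<Omega> \<longleftrightarrow> \<gamma> (vector [Q x $ 1, Q x $ 2]) < Q x $ 3))"


section \<open>The Lebesgue space \<open>L\<^sup>2(\<Omega>)\<close>\<close>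

text \<open>
  Elements are represented by functions; two functions represent the same element iff they
  agree almost everywhere in \<open>\<Omega>\<close>.  For values in \<open>real^3^3\<close> the inner product below is the
  Frobenius one.
\<close>

definition L2_space :: "(real^3) set \<Rightarrow> (real^3 \<Rightarrow> 'b::euclidean_space) set" where
  "L2_space \<Omega> = {u. u \<in> borel_measurable (lebesgue_on \<Omega>) \<and>
                     integrable (lebesgue_on \<Omega>) (\<lambda>x. (norm (u x))\<^sup>2)}"

definition L2_inner ::
    "(real^3) set \<Rightarrow> (real^3 \<Rightarrow> 'b::euclidean_space) \<Rightarrow> (real^3 \<Rightarrow> 'b) \<Rightarrow> real" where
  "L2_inner \<Omega> u w = integral\<^sup>L (lebesgue_on \<Omega>) (\<lambda>x. u x \<bullet> w x)"

definition L2_norm :: "(real^3) set \<Rightarrow> (real^3 \<Rightarrow> 'b::euclidean_space) \<Rightarrow> real" where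
  "L2_norm \<Omega> u = sqrt (L2_inner \<Omega> u u)"

text \<open>
  A (possibly nonlinear) map of \<open>L\<^sup>2(\<Omega>; \<real>\<^sup>3)\<close> into itself: it respects equality almost everywhere.
\<close>

definition L2_operator :: "(real^3) set \<Rightarrow> ((real^3 \<Rightarrow> real^3) \<Rightarrow> (real^3 \<Rightarrow> real^3)) \<Rightarrow> bool" where
  "L2_operator \<Omega> P \<longleftrightarrow>
     (\<forall>u\<in>L2_space \<Omega>. P u \<in> L2_space \<Omega>) \<and>
     (\<forall>u\<in>L2_space \<Omega>. \<forall>w\<in>L2_space \<Omega>.
        (AE x in lebesgue_on \<Omega>. u x = w x) \<longrightarrow> (AE x in lebesgue_on \<Omega>. P u x = P w x))"

text \<open>\<open>f \<in> C\<^sup>1([0,T]; L\<^sup>2(\<Omega>; \<real>\<^sup>3))\<close>, with one-sided derivatives at the end points.\<close>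

definition C1_L2 :: "real \<Rightarrow> (real^3) set \<Rightarrow> (real \<Rightarrow> real^3 \<Rightarrow> real^3) \<Rightarrow> bool" where
  "C1_L2 T \<Omega> f \<longleftrightarrow>
     (\<forall>t\<in>{0..T}. f t \<in> L2_space \<Omega>) \<and>
     (\<exists>f'. \<forall>t\<in>{0..T}.
        f' t \<in> L2_space \<Omega> \<and>
        ((\<lambda>s. L2_norm \<Omega> (\<lambda>x. (f s x - f t x) /\<^sub>R (s - t) - f' t x)) \<longlongrightarrow> 0) (at t within {0..T}) \<and>
        ((\<lambda>s. L2_norm \<Omega> (\<lambda>x. f' s x - f' t x)) \<longlongrightarrow> 0) (at t within {0..T}))"


section \<open>Weak gradients and \<open>H\<^sup>1(\<Omega>; \<real>\<^sup>3)\<close>\<close>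

definition partial_deriv :: "3 \<Rightarrow> (real^3 \<Rightarrow> real) \<Rightarrow> real^3 \<Rightarrow> real" where
  "partial_deriv j \<phi> x = frechet_derivative \<phi> (at x) (axis j 1)"

text \<open>
  \<open>C\<^sub>c\<^sup>\<infinity>(\<Omega>)\<close>, each function being extended by zero to the whole space: all iterated partial
  derivatives are differentiable and the support is a compact subset of \<open>\<Omega>\<close>.
\<close>

definition test_functions :: "(real^3) set \<Rightarrow> (real^3 \<Rightarrow> real) set" where
  "test_functions \<Omega> = {\<phi>.
     (\<forall>js. foldr partial_deriv js \<phi> differentiable_on UNIV) \<and>
     compact (closure {x. \<phi> x \<noteq> 0}) \<and> closure {x. \<phi> x \<noteq> 0} \<subseteq> \<Omega>}"

definition is_weak_gradient ::
    "(real^3) set \<Rightarrow> (real^3 \<Rightarrow> real^3) \<Rightarrow> (real^3 \<Rightarrow> real^3^3) \<Rightarrow> bool" where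
  "is_weak_gradient \<Omega> w G \<longleftrightarrow>
     (\<forall>i j. \<forall>\<phi>\<in>test_functions \<Omega>.
        integral\<^sup>L (lebesgue_on \<Omega>) (\<lambda>x. w x $ i * partial_deriv j \<phi> x) =
        - integral\<^sup>L (lebesgue_on \<Omega>) (\<lambda>x. G x $ i $ j * \<phi> x))"

definition H1_space :: "(real^3) set \<Rightarrow> (real^3 \<Rightarrow> real^3) set" where
  "H1_space \<Omega> = {w \<in> L2_space \<Omega>. \<exists>G\<in>L2_space \<Omega>. is_weak_gradient \<Omega> w G}"

text \<open>A representative of the weak gradient, which is unique almost everywhere in \<open>\<Omega>\<close>.\<close>

definition grad :: "(real^3) set \<Rightarrow> (real^3 \<Rightarrow> real^3) \<Rightarrow> real^3 \<Rightarrow> real^3^3" where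
  "grad \<Omega> w = (SOME G. G \<in> L2_space \<Omega> \<and> is_weak_gradient \<Omega> w G)"


section \<open>Finite element spaces\<close>

text \<open>
  The library predicate \<^const>\<open>triangulation\<close> says that there are finitely many simplices and
  that any two of them meet in a common (possibly empty) face.
\<close>

definition tetrahedral_triangulation ::
    "(real^3) set \<Rightarrow> (real^3) set set \<Rightarrow> real \<Rightarrow> bool" where
  "tetrahedral_triangulation \<Omega> \<T> h \<longleftrightarrow>
     triangulation \<T> \<and> (\<forall>K\<in>\<T>. 3 simplex K) \<and> \<Union>\<T> = closure \<Omega> \<and> h = Max (diameter ` \<T>)"

definition vertices :: "(real^3) set set \<Rightarrow> (real^3) set" where
  "vertices \<T> = (\<Union>K\<in>\<T>. {z. z extreme_point_of K})"

text \<open>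
  Functions on the closure \<open>\<Union>\<T>\<close> of the domain are represented by functions on the whole space
  that vanish outside \<open>\<Union>\<T>\<close>, so that equality in the finite element spaces is equality of
  HOL functions.
\<close>

definition P1_space :: "(real^3) set set \<Rightarrow> (real^3 \<Rightarrow> real) set" where
  "P1_space \<T> = {u. continuous_on (\<Union>\<T>) u \<and>
                     (\<forall>K\<in>\<T>. \<exists>a b. \<forall>x\<in>K. u x = a \<bullet> x + b) \<and>
                     (\<forall>x. x \<notin> \<Union>\<T> \<longrightarrow> u x = 0)}"

definition P1_space3 :: "(real^3) set set \<Rightarrow> (real^3 \<Rightarrow> real^3) set" where
  "P1_space3 \<T> = {w. \<forall>i. (\<lambda>x. w x $ i) \<in> P1_space \<T>}"

definition unit_P1_space3 :: "(real^3) set set \<Rightarrow> (real^3 \<Rightarrow> real^3) set" where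
  "unit_P1_space3 \<T> = {m \<in> P1_space3 \<T>. \<forall>z\<in>vertices \<T>. norm (m z) = 1}"

definition nodal_basis :: "(real^3) set set \<Rightarrow> real^3 \<Rightarrow> real^3 \<Rightarrow> real" where
  "nodal_basis \<T> z =
     (THE \<phi>. \<phi> \<in> P1_space \<T> \<and> (\<forall>z'\<in>vertices \<T>. \<phi> z' = (if z' = z then 1 else 0)))"

definition nodal_interpolant ::
    "(real^3) set set \<Rightarrow> (real^3 \<Rightarrow> real^3) \<Rightarrow> real^3 \<Rightarrow> real^3" where
  "nodal_interpolant \<T> g x = (\<Sum>z\<in>vertices \<T>. nodal_basis \<T> z x *\<^sub>R g z)"

definition lumped_weight :: "(real^3) set \<Rightarrow> (real^3) set set \<Rightarrow> real^3 \<Rightarrow> real" where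
  "lumped_weight \<Omega> \<T> z = integral\<^sup>L (lebesgue_on \<Omega>) (nodal_basis \<T> z)"

definition lumped_inner ::
    "(real^3) set \<Rightarrow> (real^3) set set \<Rightarrow> (real^3 \<Rightarrow> real^3) \<Rightarrow> (real^3 \<Rightarrow> real^3) \<Rightarrow> real" where
  "lumped_inner \<Omega> \<T> u w = (\<Sum>z\<in>vertices \<T>. lumped_weight \<Omega> \<T> z * (u z \<bullet> w z))"

text \<open>The next two maps are meant for arguments in \<^term>\<open>H1_space \<Omega>\<close> and \<^term>\<open>L2_space \<Omega>\<close>.\<close>

definition discrete_laplacian ::
    "(real^3) set \<Rightarrow> (real^3) set set \<Rightarrow> (real^3 \<Rightarrow> real^3) \<Rightarrow> real^3 \<Rightarrow> real^3" where
  "discrete_laplacian \<Omega> \<T> w =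
     (THE d. d \<in> P1_space3 \<T> \<and>
        (\<forall>wh\<in>P1_space3 \<T>. - lumped_inner \<Omega> \<T> d wh = L2_inner \<Omega> (grad \<Omega> w) (grad \<Omega> wh)))"

definition lumped_projection ::
    "(real^3) set \<Rightarrow> (real^3) set set \<Rightarrow> (real^3 \<Rightarrow> real^3) \<Rightarrow> real^3 \<Rightarrow> real^3" where
  "lumped_projection \<Omega> \<T> w =
     (THE p. p \<in> P1_space3 \<T> \<and>
        (\<forall>wh\<in>P1_space3 \<T>. lumped_inner \<Omega> \<T> p wh = L2_inner \<Omega> w wh))"


section \<open>The algorithm\<close>

text \<open>Discrete effective field, for the current iterate \<open>m\<close>, the velocity \<open>v\<close> and the applied
  field \<open>g\<close>.\<close>

definition effective_field ::
    "(real^3) set \<Rightarrow> (real^3) set set \<Rightarrow> real \<Rightarrow> real \<Rightarrow> real \<Rightarrow>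
     ((real^3 \<Rightarrow> real^3) \<Rightarrow> (real^3 \<Rightarrow> real^3)) \<Rightarrow>
     (real^3 \<Rightarrow> real^3) \<Rightarrow> (real^3 \<Rightarrow> real^3) \<Rightarrow> (real^3 \<Rightarrow> real^3) \<Rightarrow> real^3 \<Rightarrow> real^3" where
  "effective_field \<Omega> \<T> \<theta> ell_ex k \<pi>h g m v x =
     ell_ex\<^sup>2 *\<^sub>R discrete_laplacian \<Omega> \<T> (\<lambda>y. m y + (\<theta> * k) *\<^sub>R v y) x
     + lumped_projection \<Omega> \<T> (\<lambda>y. \<pi>h m y + g y) x"

text \<open>
  \<open>m\<close> and \<open>v\<close> form an output of the algorithm: \<open>m 0\<close> is the input, \<open>v l\<close> (for \<open>l < L\<close>) and
  \<open>m (Suc l)\<close> are the iterates computed in step \<open>l\<close>; other values of the sequences are irrelevant.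
\<close>

definition PC1_IMEX ::
    "(real^3) set \<Rightarrow> (real^3) set set \<Rightarrow> real \<Rightarrow> real \<Rightarrow> real \<Rightarrow> real \<Rightarrow> nat \<Rightarrow>
     ((real^3 \<Rightarrow> real^3) \<Rightarrow> (real^3 \<Rightarrow> real^3)) \<Rightarrow> (real \<Rightarrow> real^3 \<Rightarrow> real^3) \<Rightarrow>
     (nat \<Rightarrow> real^3 \<Rightarrow> real^3) \<Rightarrow> (nat \<Rightarrow> real^3 \<Rightarrow> real^3) \<Rightarrow> bool" where
  "PC1_IMEX \<Omega> \<T> \<alpha> \<theta> ell_ex k L \<pi>h f m v \<longleftrightarrow>
     m 0 \<in> unit_P1_space3 \<T> \<and>
     (\<forall>l<L.
        v l \<in> P1_space3 \<T> \<and>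
        (\<forall>wh\<in>P1_space3 \<T>.
           let H = effective_field \<Omega> \<T> \<theta> ell_ex k \<pi>h (f (real l * k)) (m l) (v l)
           in (1 + \<alpha>\<^sup>2) * lumped_inner \<Omega> \<T> (v l) wh =
                - lumped_inner \<Omega> \<T> (\<lambda>x. m l x \<times> H x) wh
                - \<alpha> * lumped_inner \<Omega> \<T> (\<lambda>x. m l x \<times> (m l x \<times> H x)) wh) \<and>
        m (Suc l) \<in> unit_P1_space3 \<T> \<and>
        (\<forall>z\<in>vertices \<T>.
           m (Suc l) z = (m l z + k *\<^sub>R v l z) /\<^sub>R norm (m l z + k *\<^sub>R v l z)))"

end

theory Submission
  imports Defs
begin

text \<open>
  Testing the velocity equation with nodal basis functions turns it into an identity at each
  vertex, from which \<open>m \<bullet> v = 0\<close> and \<open>\<alpha> |v|\<^sup>2 = H \<bullet> v\<close> follow by cross product algebra, \<open>H\<close> being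
  the discrete effective field.  Summation over the vertices gives the energy law
  \<open>\<alpha> \<langle>v,v\<rangle>\<^sub>h = - ell_ex\<^sup>2 \<langle>\<nabla>(m + \<theta> k v), \<nabla>v\<rangle> + \<langle>v, \<pi>\<^sub>h m + f\<rangle>\<close>, and mass lumping only increases
  the norm.  Since \<open>|m + k v| \<ge> 1\<close> at the vertices, the mesh condition bounds \<open>\<parallel>\<nabla>m'\<parallel>\<^sup>2\<close> for the
  projected iterate \<open>m'\<close> by \<open>\<parallel>\<nabla>(m + k v)\<parallel>\<^sup>2\<close>; expanding this square and summing over the time
  steps finishes the proof.

  The gradients being arbitrary representatives of weak gradients, bilinearity of the Dirichlet
  form needs both existence of the weak gradient of a piecewise affine function and uniqueness
  almost everywhere.  Uniqueness is tested on smooth bump functions of boxes; existence is shown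
  by integrating difference quotients.
\<close>

section \<open>Smooth bump functions of boxes\<close>

text \<open>Cross products of finite element functions leave the finite element space, but the
  lumped product reads nodal values only and its weights are positive, so the variational equation
  is in fact collocation at the vertices. The Dirichlet form is the obstacle. \<open>grad\<close>
  chooses each representative independently, so additivity may fail pointwise.
  \<open>discrete_laplacian\<close> and \<open>lumped_projection\<close> are definite descriptions,
  whose defining equations become available only after existence and uniqueness are shown for linear
  right-hand sides; hence bilinearity of the Dirichlet form precedes every property of the
  Laplacian. No divergence theorem on tetrahedra enters: the product of a piecewise affine function
  and a test function has bounded difference quotients along lines, and it is differentiable off the
  faces, a null set. The factor \<theta> - 1/2 balances two multiples of k^2 times the squared norm
  of the gradient of \<open>v\<close>: the implicit Laplacian supplies \<theta>, the expansion of
  the updated energy costs 1/2, and the mixed terms cancel.\<close>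

primrec times_differentiable :: "nat \<Rightarrow> (real \<Rightarrow> real) \<Rightarrow> bool" where
  "times_differentiable 0 f \<longleftrightarrow> True"
| "times_differentiable (Suc n) f \<longleftrightarrow>
     (\<exists>f'. (\<forall>x. (f has_real_derivative f' x) (at x)) \<and> times_differentiable n f')"

text \<open>Quantifying over finite orders turns every closure property into an induction on the
  order.\<close>

definition smooth_real :: "(real \<Rightarrow> real) \<Rightarrow> bool" where
  "smooth_real f \<longleftrightarrow> (\<forall>n. times_differentiable n f)"

lemma times_differentiable_SucD: "times_differentiable (Suc n) f \<Longrightarrow> times_differentiable n f"
proof (induction n arbitrary: f)
  case (Suc n)
  then obtain f' where "\<forall>x. (f has_real_derivative f' x) (at x)" "times_differentiable (Suc n) f'"
    unfolding times_differentiable.simps(2)[of "Suc n"] by blast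
  with Suc.IH show ?case by auto
qed auto

lemma times_differentiable_add:
  "times_differentiable n f \<Longrightarrow> times_differentiable n g \<Longrightarrow> times_differentiable n (\<lambda>x. f x + g x)"
proof (induction n arbitrary: f g)
  case (Suc n)
  then obtain f' g' where "\<forall>x. (f has_real_derivative f' x) (at x)" "times_differentiable n f'"
    "\<forall>x. (g has_real_derivative g' x) (at x)" "times_differentiable n g'" by auto
  with Suc.IH have "\<forall>x. ((\<lambda>x. f x + g x) has_real_derivative f' x + g' x) (at x)"
    "times_differentiable n (\<lambda>x. f' x + g' x)"
    by (auto intro!: DERIV_add)
  then show ?case by auto
qed auto

lemma times_differentiable_mult:
  "times_differentiable n f \<Longrightarrow> times_differentiable n g \<Longrightarrow> times_differentiable n (\<lambda>x. f x * g x)"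
proof (induction n arbitrary: f g)
  case (Suc n)
  then obtain f' g' where *: "\<forall>x. (f has_real_derivative f' x) (at x)" "times_differentiable n f'"
    "\<forall>x. (g has_real_derivative g' x) (at x)" "times_differentiable n g'" by auto
  \<comment> \<open>The product rule mixes derivatives with the functions themselves, so
    \<open>f\<close> and \<open>g\<close> are also needed at the lower order
    \<open>n\<close>.\<close>
  have "times_differentiable n f" "times_differentiable n g"
    using Suc.prems by (auto dest: times_differentiable_SucD simp del: times_differentiable.simps)
  then have "times_differentiable n (\<lambda>x. f' x * g x + g' x * f x)"
    using * Suc.IH by (auto intro!: times_differentiable_add)
  moreover have "\<forall>x. ((\<lambda>x. f x * g x) has_real_derivative f' x * g x + g' x * f x) (at x)"
    using * by (auto intro!: DERIV_mult)
  ultimately show ?case by auto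
qed auto

lemma times_differentiable_const: "times_differentiable n (\<lambda>x. c)"
proof (induction n arbitrary: c)
  case (Suc n)
  then show ?case by (auto intro!: exI[of _ "\<lambda>x. 0"])
qed auto

lemma times_differentiable_affine:
  "times_differentiable n f \<Longrightarrow> times_differentiable n (\<lambda>x. f (a * x + b))"
proof (induction n arbitrary: f)
  case (Suc n)
  then obtain f' where *: "\<forall>x. (f has_real_derivative f' x) (at x)" "times_differentiable n f'" by auto
  have "\<forall>x. ((\<lambda>x. f (a * x + b)) has_real_derivative f' (a * x + b) * a) (at x)"
    by (intro allI DERIV_chain'[where g=f] *(1)[rule_format])
       (auto intro!: derivative_eq_intros *(1)[rule_format])
  moreover have "times_differentiable n (\<lambda>x. f' (a * x + b) * a)"
    using Suc.IH[OF *(2)] by (intro times_differentiable_mult times_differentiable_const)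
  ultimately show ?case by auto
qed auto

lemma smooth_real_deriv:
  assumes "smooth_real f"
  obtains f' where "\<And>x. (f has_real_derivative f' x) (at x)" "smooth_real f'"
proof -
  have "times_differentiable (Suc 0) f" using assms unfolding smooth_real_def by blast
  then obtain f' where f': "\<forall>x. (f has_real_derivative f' x) (at x)" by auto
  have "times_differentiable n f'" for n
  proof -
    have "times_differentiable (Suc n) f" using assms unfolding smooth_real_def by blast
    then obtain f'' where "\<forall>x. (f has_real_derivative f'' x) (at x)" "times_differentiable n f''" by auto
    \<comment> \<open>Each order comes with its own witness for the derivative; uniqueness of
      derivatives identifies them all.\<close>
    moreover have "f'' = f'" using DERIV_unique f' calculation(1) by blast
    ultimately show ?thesis by simp
  qed
  with f' that show thesis unfolding smooth_real_def by blast
qed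

text \<open>The powers of 1/s make the family closed under differentiation up to linear
  combinations. The induction proving smoothness therefore runs over all \<open>k\<close> at once,
  although only \<open>k = 0\<close> enters the bumps.\<close>

definition flat_exp :: "nat \<Rightarrow> real \<Rightarrow> real" where
  "flat_exp k s = (if 0 < s then (1 / s) ^ k * exp (- (1 / s)) else 0)"

lemma flat_exp_deriv:
  "(flat_exp k has_real_derivative (- real k * flat_exp (Suc k) s + flat_exp (k + 2) s)) (at s)"
proof -
  consider "s < 0" | "s = 0" | "s > 0" by linarith
  then show ?thesis
  proof cases
    case 1
    have "((\<lambda>s. 0) has_real_derivative 0) (at s)" by simp
    then have "(flat_exp k has_real_derivative 0) (at s)"
      by (rule has_field_derivative_transform_within_open[where S="{..<0}"])
         (use 1 in \<open>auto simp: flat_exp_def\<close>)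
    then show ?thesis using 1 by (simp add: flat_exp_def)
  next
    case 3
    have "((\<lambda>s. (1 / s) ^ k * exp (- (1 / s))) has_real_derivative
       (- real k * flat_exp (Suc k) s + flat_exp (k + 2) s)) (at s)"
    \<comment> \<open>The power rule produces the exponent \<open>k - 1\<close>, a truncated
      subtraction, hence the case split.\<close>
    proof (cases k)
      case 0
      then show ?thesis using 3
        by (auto intro!: derivative_eq_intros simp: flat_exp_def field_simps power2_eq_square)
    next
      case (Suc j)
      show ?thesis unfolding Suc using 3
        by (auto intro!: derivative_eq_intros simp: flat_exp_def field_simps power2_eq_square
            simp del: power_Suc) (auto simp: field_simps)
    qed
    then show ?thesis
      by (rule has_field_derivative_transform_within_open[where S="{0<..}"])
         (use 3 in \<open>auto simp: flat_exp_def\<close>)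
  next
    case 2
    have "((\<lambda>y. (flat_exp k y - flat_exp k 0) / (y - 0)) \<longlongrightarrow> 0) (at 0)"
    \<comment> \<open>The quotient vanishes identically on the left; on the right it equals y^(k+1)
      / exp y with y the reciprocal of the argument, which tends to infinity.\<close>
    proof (rule filterlim_split_at)
      show "((\<lambda>y. (flat_exp k y - flat_exp k 0) / (y - 0)) \<longlongrightarrow> 0) (at_left 0)"
        by (rule tendsto_eventually) (auto simp: eventually_at_filter flat_exp_def)
      have "((\<lambda>y. inverse y ^ Suc k / exp (inverse y)) \<longlongrightarrow> (0::real)) (at_right 0)"
        by (rule filterlim_compose[OF tendsto_power_div_exp_0 filterlim_inverse_at_top_right])
      then show "((\<lambda>y. (flat_exp k y - flat_exp k 0) / (y - 0)) \<longlongrightarrow> 0) (at_right 0)"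
        by (rule Lim_transform_eventually)
           (auto simp: eventually_at_filter flat_exp_def exp_minus field_simps)
    qed
    then have "(flat_exp k has_real_derivative 0) (at 0)"
      by (simp add: has_field_derivative_iff)
    then show ?thesis using 2 by (simp add: flat_exp_def)
  qed
qed

lemma smooth_flat_exp: "smooth_real (flat_exp k)"
proof -
  have "times_differentiable n (flat_exp k)" for n
  proof (induction n arbitrary: k)
    case (Suc n)
    have "times_differentiable n (\<lambda>s. - real k * flat_exp (Suc k) s + flat_exp (k + 2) s)"
      by (intro times_differentiable_add times_differentiable_mult times_differentiable_const Suc)
    then show ?case unfolding times_differentiable.simps(2)
      by (intro exI conjI allI) (rule flat_exp_deriv)
  qed auto
  then show ?thesis by (simp add: smooth_real_def)
qed

text \<open>The two factors vanish to the left of \<open>a\<close> and to the right of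
  \<open>b\<close>. Growing \<open>n\<close> steepens both, so the bumps tend to the indicator of
  the open interval. The arguments are written as affine maps to match
  \<open>times_differentiable_affine\<close>.\<close>

definition interval_bump :: "nat \<Rightarrow> real \<Rightarrow> real \<Rightarrow> real \<Rightarrow> real" where
  "interval_bump n a b s = flat_exp 0 (real n * s + (- real n * a)) * flat_exp 0 ((- real n) * s + real n * b)"

lemma smooth_interval_bump: "smooth_real (interval_bump n a b)"
  using smooth_flat_exp[of 0] unfolding smooth_real_def interval_bump_def[abs_def]
  by (intro allI times_differentiable_mult times_differentiable_affine) auto

lemma flat_exp_0_bounds: "0 \<le> flat_exp 0 s" "flat_exp 0 s \<le> 1"
  by (auto simp: flat_exp_def)

lemma interval_bump_bounds: "0 \<le> interval_bump n a b s" "interval_bump n a b s \<le> 1"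
  unfolding interval_bump_def
  by (auto intro!: mult_nonneg_nonneg mult_le_one flat_exp_0_bounds)

lemma interval_bump_eq_0: "s \<le> a \<or> b \<le> s \<Longrightarrow> interval_bump n a b s = 0"
  using mult_left_mono[of s a "real n"] mult_left_mono[of b s "real n"]
  by (auto simp: interval_bump_def flat_exp_def)

lemma tendsto_flat_exp_0:
  assumes "s > 0" shows "(\<lambda>n. flat_exp 0 (real n * s)) \<longlonglongrightarrow> 1"
proof -
  have "(\<lambda>n. exp (- (inverse (real n) * (1/s)))) \<longlonglongrightarrow> exp (- (0 * (1/s)))"
    by (intro tendsto_intros lim_inverse_n)
  then have "(\<lambda>n. exp (- (inverse (real n) * (1/s)))) \<longlonglongrightarrow> 1" by simp
  then show ?thesis
    by (rule Lim_transform_eventually)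
       (use assms in \<open>auto simp: flat_exp_def field_simps intro!: eventually_mono[OF eventually_gt_at_top[of 0]]\<close>)
qed

lemma tendsto_interval_bump:
  assumes "a < s" "s < b" shows "(\<lambda>n. interval_bump n a b s) \<longlonglongrightarrow> 1"
proof -
  have "(\<lambda>n. flat_exp 0 (real n * (s - a)) * flat_exp 0 (real n * (b - s))) \<longlonglongrightarrow> 1 * 1"
    using assms by (intro tendsto_mult tendsto_flat_exp_0) auto
  then show ?thesis by (simp add: interval_bump_def algebra_simps)
qed

text \<open>A partial derivative acts on exactly one factor, so smooth tensor products are closed
  under \<open>partial_deriv\<close>; this handles the iterated derivatives in
  \<open>test_functions\<close>.\<close>

definition tensor3 :: "(real \<Rightarrow> real) \<Rightarrow> (real \<Rightarrow> real) \<Rightarrow> (real \<Rightarrow> real) \<Rightarrow> real^3 \<Rightarrow> real" where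
  "tensor3 a b c x = a (x $ 1) * b (x $ 2) * c (x $ 3)"

lemma tensor3_has_derivative:
  assumes "\<And>x. (a has_real_derivative a' x) (at x)" "\<And>x. (b has_real_derivative b' x) (at x)"
    "\<And>x. (c has_real_derivative c' x) (at x)"
  shows "(tensor3 a b c has_derivative (\<lambda>e. tensor3 a' b c x * e $ 1 + tensor3 a b' c x * e $ 2
     + tensor3 a b c' x * e $ 3)) (at x)"
proof -
  have comp: "((\<lambda>x. g (x $ i)) has_derivative (\<lambda>e. g' (x $ i) * e $ i)) (at x)"
    if "\<And>x. (g has_real_derivative g' x) (at x)" for g g' :: "real \<Rightarrow> real" and i :: 3 and x :: "real^3"
    by (rule has_derivative_compose[OF bounded_linear_imp_has_derivative[OF bounded_linear_vec_nth]
        that[unfolded has_field_derivative_def]])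
  show ?thesis
    unfolding tensor3_def[abs_def]
    by (rule has_derivative_eq_rhs[OF has_derivative_mult[OF has_derivative_mult[OF comp[OF assms(1)] comp[OF assms(2)]] comp[OF assms(3)]]])
       (auto simp: algebra_simps)
qed

lemma foldr_partial_deriv_tensor3:
  assumes "smooth_real a" "smooth_real b" "smooth_real c"
  shows "\<exists>a' b' c'. smooth_real a' \<and> smooth_real b' \<and> smooth_real c' \<and>
    foldr partial_deriv js (tensor3 a b c) = tensor3 a' b' c'"
proof (induction js)
  case Nil
  then show ?case using assms by auto
next
  case (Cons j js)
  define \<phi> where "\<phi> = foldr partial_deriv js (tensor3 a b c)"
  from Cons obtain a b c where s: "smooth_real a" "smooth_real b" "smooth_real c"
    and eq: "\<phi> = tensor3 a b c" unfolding \<phi>_def by blast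
  from s obtain a' b' c' where d: "\<And>x. (a has_real_derivative a' x) (at x)" "smooth_real a'"
    "\<And>x. (b has_real_derivative b' x) (at x)" "smooth_real b'"
    "\<And>x. (c has_real_derivative c' x) (at x)" "smooth_real c'"
    by (meson smooth_real_deriv)
  have "partial_deriv j (tensor3 a b c) x = tensor3 a' b c x * axis j 1 $ 1 + tensor3 a b' c x * axis j 1 $ 2
     + tensor3 a b c' x * axis j 1 $ 3" for x
    unfolding partial_deriv_def
    by (subst frechet_derivative_at[OF tensor3_has_derivative[OF d(1) d(3) d(5)], symmetric]) simp
  then have "partial_deriv j (tensor3 a b c) \<in> {tensor3 a' b c, tensor3 a b' c, tensor3 a b c'}"
    using exhaust_3[of j] by (auto simp: axis_def fun_eq_iff)
  then have "\<exists>a' b' c'. smooth_real a' \<and> smooth_real b' \<and> smooth_real c' \<and>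
      partial_deriv j \<phi> = tensor3 a' b' c'"
    using s d(2,4,6) unfolding eq by blast
  then show ?case by (simp add: \<phi>_def)
qed

definition box_bump :: "nat \<Rightarrow> real^3 \<Rightarrow> real^3 \<Rightarrow> real^3 \<Rightarrow> real" where
  "box_bump n a b =
     tensor3 (interval_bump n (a $ 1) (b $ 1)) (interval_bump n (a $ 2) (b $ 2)) (interval_bump n (a $ 3) (b $ 3))"

lemma box_bump_eq_0: "x \<notin> box a b \<Longrightarrow> box_bump n a b x = 0"
  by (auto simp: box_bump_def tensor3_def mem_box_cart forall_3 not_less intro!: interval_bump_eq_0)

lemma box_bump_bounds: "0 \<le> box_bump n a b x" "box_bump n a b x \<le> 1"
  by (auto simp: box_bump_def tensor3_def intro!: mult_nonneg_nonneg mult_le_one interval_bump_bounds)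

lemma tendsto_box_bump: "(\<lambda>n. box_bump n a b x) \<longlonglongrightarrow> indicator (box a b) x"
proof (cases "x \<in> box a b")
  case True
  then have "(\<lambda>n. box_bump n a b x) \<longlonglongrightarrow> 1 * 1 * 1"
    unfolding box_bump_def tensor3_def
    by (intro tendsto_mult tendsto_interval_bump) (auto simp: mem_box_cart)
  then show ?thesis using True by simp
qed (simp add: box_bump_eq_0)

lemma box_bump_test_function:
  assumes "cbox a b \<subseteq> \<Omega>"
  shows "box_bump n a b \<in> test_functions \<Omega>"
proof -
  have "foldr partial_deriv js (box_bump n a b) differentiable_on UNIV" for js
  proof -
    obtain a' b' c' where s: "smooth_real a'" "smooth_real b'" "smooth_real c'" 
      "foldr partial_deriv js (box_bump n a b) = tensor3 a' b' c'"
      using foldr_partial_deriv_tensor3[OF smooth_interval_bump smooth_interval_bump smooth_interval_bump]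
      unfolding box_bump_def by blast
    obtain a'' where a'': "\<And>x. (a' has_real_derivative a'' x) (at x)"
      using smooth_real_deriv[OF s(1)] by blast
    obtain b'' where b'': "\<And>x. (b' has_real_derivative b'' x) (at x)"
      using smooth_real_deriv[OF s(2)] by blast
    obtain c'' where c'': "\<And>x. (c' has_real_derivative c'' x) (at x)"
      using smooth_real_deriv[OF s(3)] by blast
    show ?thesis
      unfolding s(4) differentiable_on_def differentiable_def
      using tensor3_has_derivative[OF a'' b'' c''] by auto
  qed
  moreover have "closure {x. box_bump n a b x \<noteq> 0} \<subseteq> cbox a b"
    using box_bump_eq_0 box_subset_cbox by (intro closure_minimal) fastforce+
  moreover from this have "compact (closure {x. box_bump n a b x \<noteq> 0})"
    using bounded_subset[OF bounded_cbox] by (auto simp: compact_eq_bounded_closed)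
  ultimately show ?thesis using assms unfolding test_functions_def by auto
qed

section \<open>The fundamental lemma of the calculus of variations\<close>

text \<open>A Dynkin class argument: open boxes are stable under intersection and generate the Borel
  sets. Complements call for the integral over the whole space, which is not a box, hence the
  separate assumption \<open>total\<close>.\<close>

lemma set_integral_zero_of_box_integrals:
  fixes f :: "real^3 \<Rightarrow> real"
  assumes f: "integrable lborel f"
    and total: "integral\<^sup>L lborel f = 0"
    and box: "\<And>c d. (LINT x:box c d|lborel. f x) = 0"
    and A: "A \<in> sets lborel"
  shows "(LINT x:A|lborel. f x) = 0"
proof -
  have int: "set_integrable lborel A f" if "A \<in> sets borel" for A
    unfolding set_integrable_def using that f by (intro integrable_mult_indicator) auto
  define G where "G = range (\<lambda>(a, b). box a b :: (real^3) set)"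
  have sig: "sigma_sets UNIV G = sets borel"
    unfolding borel_eq_box G_def[symmetric] by simp
  have "Int_stable G"
  proof (rule Int_stableI)
    fix X Y assume "X \<in> G" "Y \<in> G"
    then obtain a b c d where "X = box a b" "Y = box c d" by (auto simp: G_def)
    then show "X \<inter> Y \<in> G" by (auto simp: G_def box_Int_box)
  qed
  moreover have "G \<subseteq> Pow UNIV" by auto
  moreover have "A \<in> sigma_sets UNIV G" using A sig by simp
  ultimately show ?thesis
  proof (induction rule: sigma_sets_induct_disjoint)
    case (basic A)
    then show ?case using box by (auto simp: G_def)
  next
    case empty
    then show ?case by (simp add: set_lebesgue_integral_def)
  next
    case (compl A)
    then have A: "A \<in> sets borel" using sig by simp
    have "(LINT x:A \<union> (UNIV - A)|lborel. f x) = (LINT x:A|lborel. f x) + (LINT x:UNIV - A|lborel. f x)"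
      using A by (intro set_integral_Un int) auto
    then show ?case using compl total by (simp add: set_lebesgue_integral_def)
  next
    case (union A)
    then have A: "A i \<in> sets borel" for i using sig by auto
    have "(LINT x:(\<Union>i. A i)|lborel. f x) = (\<Sum>i. (LINT x:(A i)|lborel. f x))"
      using A union(1) by (intro lebesgue_integral_countable_add int) (auto simp: disjoint_family_on_def)
    then show ?case using union by simp
  qed
qed

lemma box_in_sets_lebesgue: "box a b \<in> sets lebesgue"
  using open_box by auto

lemma AE_zero_of_box_integrals:
  fixes g :: "real^3 \<Rightarrow> real"
  assumes \<Omega>: "open \<Omega>" and g: "integrable (lebesgue_on \<Omega>) g"
    and box: "\<And>a b. cbox a b \<subseteq> \<Omega> \<Longrightarrow> integral\<^sup>L (lebesgue_on \<Omega>) (\<lambda>x. g x * indicator (box a b) x) = 0"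
  shows "AE x in lebesgue_on \<Omega>. g x = 0"
proof -
  have [simp, measurable]: "\<Omega> \<in> sets lebesgue" using \<Omega> by auto
  have gi: "integrable lebesgue (\<lambda>x. indicator \<Omega> x * g x)"
    using g by (simp add: integrable_restrict_space)
  \<comment> \<open>One closed box at a time suffices. Cut off by the box, \<open>g\<close> becomes
    integrable on the whole space, and its total integral is itself a box integral.\<close>
  have *: "AE x in lebesgue. x \<in> cbox a b \<longrightarrow> g x = 0" if ab: "cbox a b \<subseteq> \<Omega>" for a b
  proof -
    define f where "f x = indicator (box a b) x * g x" for x
    have eq: "f x = indicator (box a b) x * (indicator \<Omega> x * g x)" for x
      using ab box_subset_cbox by (auto simp: f_def indicator_def)
    have f: "integrable lebesgue f"
      using integrable_mult_indicator[of "box a b" lebesgue, OF _ gi]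
      by (simp add: eq[abs_def])
    then have fm: "f \<in> borel_measurable lebesgue" by simp
    \<comment> \<open>The Dynkin argument is about Borel measurable functions, so \<open>f\<close>
      is replaced by a Borel version that agrees with it almost everywhere.\<close>
    then obtain f' where f'm: "f' \<in> borel_measurable lborel" and ff': "AE x in lborel. f x = f' x"
      using completion_ex_borel_measurable_real by blast
    have ff'L: "AE x in lebesgue. f x = f' x" using AE_completion[OF ff'] .
    have f'mL: "f' \<in> borel_measurable lebesgue" using f'm by (rule measurable_completion)
    have "integrable lebesgue f'"
      using integrable_cong_AE[OF fm f'mL ff'L] f by simp
    then have f'i: "integrable lborel f'"
      using f'm by (simp add: integrable_completion)
    have boxes: "(LINT x|lborel. indicator (box c d) x * f' x) = 0" for c d
    proof -
      have "(LINT x|lborel. indicator (box c d) x * f' x) = (LINT x|lebesgue. indicator (box c d) x * f' x)"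
        using f'm by (intro integral_completion[symmetric]) auto
      also have "\<dots> = (LINT x|lebesgue. indicator (box c d) x * f x)"
        using f'mL fm ff'L
        by (intro integral_cong_AE borel_measurable_times borel_measurable_indicator box_in_sets_lebesgue) auto
      also have "\<dots> = 0"
      proof -
        obtain p q where pq: "box c d \<inter> box a b = box p q" by (simp add: box_Int_box)
        then have sub: "box p q \<subseteq> \<Omega>" using ab box_subset_cbox by blast
        show ?thesis
        \<comment> \<open>If the open box is empty, \<open>cbox p q\<close> may still be a
          degenerate nonempty box outside \<Omega>, so the assumption on boxes is usable only in the
          other case.\<close>
        proof (cases "box p q = {}")
          case True
          then have "indicator (box c d) x * f x = 0" for x
            using pq by (auto simp: f_def indicator_def)
          then show ?thesis by (intro integral_eq_zero_AE AE_I2) blast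
        next
          case False
          then have "closure (box p q) = cbox p q" by (simp add: closure_box)
          then have "cbox p q \<subseteq> \<Omega>"
            using pq ab closure_mono[of "box p q" "cbox a b"] box_subset_cbox[of a b]
            by fastforce
          from box[OF this] have "integral\<^sup>L lebesgue (\<lambda>x. indicator \<Omega> x * (g x * indicator (box p q) x)) = 0"
            by (simp add: integral_restrict_space)
          moreover have "indicator \<Omega> x * (g x * indicator (box p q) x) = indicator (box c d) x * f x" for x
            using sub unfolding pq[symmetric] f_def by (auto simp: indicator_def)
          ultimately show ?thesis by simp
        qed
      qed
      finally show ?thesis .
    qed
    have "(LINT x|lborel. f' x) = (LINT x|lborel. indicator (box a b) x * f' x)"
      using ff' f'm by (intro integral_cong_AE) (auto simp: f_def indicator_def)
    then have total: "(LINT x|lborel. f' x) = 0" using boxes by simp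
    have "AE x in lborel. f' x = 0"
      using set_integral_zero_of_box_integrals[OF f'i total] boxes
      by (intro density_unique_real[OF f'i]) (auto simp: set_lebesgue_integral_def)
    then have "AE x in lebesgue. f' x = 0" by (rule AE_completion)
    with ff'L have "AE x in lebesgue. f x = 0" by eventually_elim simp
    moreover have "AE x in lebesgue. x \<notin> cbox a b - box a b"
      using negligible_frontier_interval[of a b] by (intro AE_not_in) (simp add: negligible_iff_null_sets)
    ultimately show ?thesis
      by eventually_elim (auto simp: f_def indicator_def)
  qed
  \<comment> \<open>An open set is a countable union of closed boxes, so the exceptional null sets
    can be collected.\<close>
  obtain D where D: "countable D" "\<And>X. X \<in> D \<Longrightarrow> X \<subseteq> \<Omega> \<and> (\<exists>a b. X = cbox a b)" "\<Union>D = \<Omega>"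
    using open_countable_Union_open_cbox[OF \<Omega>] by (metis PowD subsetD)
  have "AE x in lebesgue. \<forall>X\<in>D. x \<in> X \<longrightarrow> g x = 0"
    using D(2) * by (subst AE_ball_countable[OF D(1)]) blast
  then have "AE x in lebesgue. x \<in> \<Omega> \<longrightarrow> g x = 0"
    by eventually_elim (use D(3) in blast)
  then show ?thesis by (simp add: AE_restrict_space_iff)
qed

text \<open>The bumps of a box tend pointwise to its indicator and lie between 0 and 1, so dominated
  convergence with majorant |g| reduces the claim to box integrals.\<close>

lemma AE_zero_of_test_functions:
  fixes g :: "real^3 \<Rightarrow> real"
  assumes \<Omega>: "open \<Omega>" and g: "integrable (lebesgue_on \<Omega>) g"
    and test: "\<And>\<phi>. \<phi> \<in> test_functions \<Omega> \<Longrightarrow> integral\<^sup>L (lebesgue_on \<Omega>) (\<lambda>x. g x * \<phi> x) = 0"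
  shows "AE x in lebesgue_on \<Omega>. g x = 0"
proof (rule AE_zero_of_box_integrals[OF \<Omega> g])
  fix a b assume ab: "cbox a b \<subseteq> \<Omega>"
  note bump = box_bump_test_function[OF ab]
  have "continuous_on UNIV (box_bump n a b)" for n
    using bump[of n] differentiable_imp_continuous_on[of "box_bump n a b"]
    unfolding test_functions_def by (metis (mono_tags, lifting) foldr_Nil id_apply mem_Collect_eq)
  then have m: "box_bump n a b \<in> borel_measurable (lebesgue_on \<Omega>)" for n
    by (metis borel_measurable_continuous_onI measurable_completion measurable_lborel2 measurable_restrict_space1)
  have gm: "g \<in> borel_measurable (lebesgue_on \<Omega>)" using g by simp
  have bm: "(indicator (box a b) :: real^3 \<Rightarrow> real) \<in> borel_measurable (lebesgue_on \<Omega>)"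
    by (intro measurable_restrict_space1 borel_measurable_indicator box_in_sets_lebesgue)
  have "(\<lambda>n. integral\<^sup>L (lebesgue_on \<Omega>) (\<lambda>x. g x * box_bump n a b x)) \<longlonglongrightarrow>
      integral\<^sup>L (lebesgue_on \<Omega>) (\<lambda>x. g x * indicator (box a b) x)"
  proof (rule integral_dominated_convergence[where w="\<lambda>x. norm (g x)"])
    show "AE x in lebesgue_on \<Omega>. (\<lambda>n. g x * box_bump n a b x) \<longlonglongrightarrow> g x * indicator (box a b) x"
      by (intro AE_I2 tendsto_mult tendsto_const tendsto_box_bump)
    show "AE x in lebesgue_on \<Omega>. norm (g x * box_bump n a b x) \<le> norm (g x)" for n
      using box_bump_bounds by (intro AE_I2) (simp add: abs_mult mult_left_le)
  qed (use g gm m bm in auto)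
  then show "integral\<^sup>L (lebesgue_on \<Omega>) (\<lambda>x. g x * indicator (box a b) x) = 0"
    using test[OF bump] by (simp add: LIMSEQ_const_iff)
qed

section \<open>Weak gradients in \<open>L\<^sup>2\<close>\<close>

lemma L2_inner_integrable:
  assumes "u \<in> L2_space \<Omega>" "w \<in> L2_space \<Omega>"
  shows "integrable (lebesgue_on \<Omega>) (\<lambda>x. u x \<bullet> w x)"
proof (rule Bochner_Integration.integrable_bound)
  show "integrable (lebesgue_on \<Omega>) (\<lambda>x. (norm (u x))\<^sup>2 + (norm (w x))\<^sup>2)"
    using assms by (intro Bochner_Integration.integrable_add) (auto simp: L2_space_def)
  show "(\<lambda>x. u x \<bullet> w x) \<in> borel_measurable (lebesgue_on \<Omega>)"
    using assms by (intro borel_measurable_inner) (auto simp: L2_space_def)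
  have "norm (u x \<bullet> w x) \<le> norm ((norm (u x))\<^sup>2 + (norm (w x))\<^sup>2)" for x
  proof -
    have "\<bar>u x \<bullet> w x\<bar> \<le> norm (u x) * norm (w x)" by (rule Cauchy_Schwarz_ineq2)
    also have "\<dots> \<le> (norm (u x))\<^sup>2 + (norm (w x))\<^sup>2"
      using sum_squares_bound[of "norm (u x)" "norm (w x)"] mult_nonneg_nonneg[OF norm_ge_zero[of "u x"] norm_ge_zero[of "w x"]]
      by linarith
    finally show ?thesis by simp
  qed
  then show "AE x in lebesgue_on \<Omega>. norm (u x \<bullet> w x) \<le> norm ((norm (u x))\<^sup>2 + (norm (w x))\<^sup>2)"
    by simp
qed

lemma L2_space_add:
  assumes "u \<in> L2_space \<Omega>" "w \<in> L2_space \<Omega>"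
  shows "(\<lambda>x. u x + w x) \<in> L2_space \<Omega>"
proof -
  have "integrable (lebesgue_on \<Omega>) (\<lambda>x. (norm (u x))\<^sup>2 + 2 * (u x \<bullet> w x) + (norm (w x))\<^sup>2)"
    using assms L2_inner_integrable[OF assms]
    by (intro Bochner_Integration.integrable_add Bochner_Integration.integrable_mult_right)
       (auto simp: L2_space_def)
  moreover have "(norm (u x + w x))\<^sup>2 = (norm (u x))\<^sup>2 + 2 * (u x \<bullet> w x) + (norm (w x))\<^sup>2" for x
    by (simp add: power2_norm_eq_inner inner_add inner_commute)
  ultimately show ?thesis using assms by (auto simp: L2_space_def)
qed

lemma L2_space_bounded_linear:
  fixes u :: "real^3 \<Rightarrow> 'b::euclidean_space" and f :: "'b \<Rightarrow> 'c::euclidean_space"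
  assumes u: "u \<in> L2_space \<Omega>" and f: "bounded_linear f"
  shows "(\<lambda>x. f (u x)) \<in> L2_space \<Omega>"
proof -
  obtain K where K: "\<And>x. norm (f x) \<le> norm x * K" using bounded_linear.bounded[OF f] by blast
  have m: "(\<lambda>x. f (u x)) \<in> borel_measurable (lebesgue_on \<Omega>)"
    using u bounded_linear.continuous_on[OF f continuous_on_id]
    by (intro measurable_compose[of u _ borel f] borel_measurable_continuous_onI)
       (auto simp: L2_space_def)
  have "integrable (lebesgue_on \<Omega>) (\<lambda>x. (norm (f (u x)))\<^sup>2)"
  proof (rule Bochner_Integration.integrable_bound)
    show "integrable (lebesgue_on \<Omega>) (\<lambda>x. K\<^sup>2 * (norm (u x))\<^sup>2)"
      using u by (auto simp: L2_space_def)
    show "(\<lambda>x. (norm (f (u x)))\<^sup>2) \<in> borel_measurable (lebesgue_on \<Omega>)"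
      using m by measurable
    have "norm ((norm (f (u x)))\<^sup>2) \<le> norm (K\<^sup>2 * (norm (u x))\<^sup>2)" for x
      using power_mono[OF K[of "u x"] norm_ge_zero, of 2] by (simp add: power_mult_distrib mult.commute)
    then show "AE x in lebesgue_on \<Omega>. norm ((norm (f (u x)))\<^sup>2) \<le> norm (K\<^sup>2 * (norm (u x))\<^sup>2)" by simp
  qed
  with m show ?thesis by (simp add: L2_space_def)
qed

lemma L2_space_scaleR: "u \<in> L2_space \<Omega> \<Longrightarrow> (\<lambda>x. c *\<^sub>R u x) \<in> L2_space \<Omega>"
  by (rule L2_space_bounded_linear) (auto intro: bounded_linear_scaleR_right)

lemma L2_space_nth:
  fixes u :: "real^3 \<Rightarrow> 'b::euclidean_space^'n"
  shows "u \<in> L2_space \<Omega> \<Longrightarrow> (\<lambda>x. u x $ i) \<in> L2_space \<Omega>"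
  by (rule L2_space_bounded_linear) (auto intro: bounded_linear_vec_nth)

lemma L2_space_bounded:
  fixes u :: "real^3 \<Rightarrow> 'b::euclidean_space"
  assumes \<Omega>: "\<Omega> \<in> lmeasurable" and m: "u \<in> borel_measurable (lebesgue_on \<Omega>)"
    and B: "\<And>x. x \<in> \<Omega> \<Longrightarrow> norm (u x) \<le> B"
  shows "u \<in> L2_space \<Omega>"
proof -
  interpret finite_measure "lebesgue_on \<Omega>" using \<Omega> by (rule finite_measure_lebesgue_on)
  have "norm ((norm (u x))\<^sup>2) \<le> B\<^sup>2" if "x \<in> \<Omega>" for x
    using power_mono[OF B[OF that] norm_ge_zero, of 2] by simp
  then have "integrable (lebesgue_on \<Omega>) (\<lambda>x. (norm (u x))\<^sup>2)"
    using m by (intro integrable_const_bound[where B="B\<^sup>2"]) (auto intro!: AE_I2)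
  with m show ?thesis by (simp add: L2_space_def)
qed

text \<open>Pairing with the constant 1, which is square integrable on a set of finite
  measure.\<close>

lemma L2_space_integrable:
  fixes u :: "real^3 \<Rightarrow> real"
  assumes "\<Omega> \<in> lmeasurable" "u \<in> L2_space \<Omega>"
  shows "integrable (lebesgue_on \<Omega>) u"
  using L2_inner_integrable[OF assms(2) L2_space_bounded[OF assms(1), of "\<lambda>x. 1" 1]] by simp

lemma L2_inner_commute: "L2_inner \<Omega> u w = L2_inner \<Omega> w u"
  by (simp add: L2_inner_def inner_commute)

lemma L2_inner_add_scaleR_left:
  assumes "u \<in> L2_space \<Omega>" "v \<in> L2_space \<Omega>" "w \<in> L2_space \<Omega>"
  shows "L2_inner \<Omega> (\<lambda>x. u x + c *\<^sub>R v x) w = L2_inner \<Omega> u w + c * L2_inner \<Omega> v w"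
  using L2_inner_integrable[OF assms(1,3)] L2_inner_integrable[OF assms(2,3)]
  by (simp add: L2_inner_def inner_add_left)

lemma L2_inner_cong_AE:
  assumes "u \<in> L2_space \<Omega>" "u' \<in> L2_space \<Omega>" "w \<in> L2_space \<Omega>"
    and "AE x in lebesgue_on \<Omega>. u x = u' x"
  shows "L2_inner \<Omega> u w = L2_inner \<Omega> u' w"
  unfolding L2_inner_def using assms
  by (intro integral_cong_AE) (auto simp: L2_space_def)

lemma L2_norm_power2: "(L2_norm \<Omega> u)\<^sup>2 = L2_inner \<Omega> u u"
proof -
  have "0 \<le> L2_inner \<Omega> u u" unfolding L2_inner_def by (rule Bochner_Integration.integral_nonneg) simp
  then show ?thesis by (simp add: L2_norm_def)
qed

section \<open>Test functions and their derivatives as elements of L2\<close>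

lemma test_function_differentiable:
  assumes "\<phi> \<in> test_functions \<Omega>" shows "\<phi> differentiable (at x)"
proof -
  have "foldr partial_deriv [] \<phi> differentiable_on UNIV" using assms unfolding test_functions_def by blast
  then show ?thesis by (simp add: differentiable_on_def)
qed

lemma test_function_continuous:
  assumes "\<phi> \<in> test_functions \<Omega>" shows "continuous_on UNIV \<phi>"
  using test_function_differentiable[OF assms]
  by (simp add: continuous_on_eq_continuous_at differentiable_imp_continuous_within)

lemma test_function_measurable:
  assumes "\<phi> \<in> test_functions \<Omega>" shows "\<phi> \<in> borel_measurable (lebesgue_on \<Omega>)"
  by (metis borel_measurable_continuous_onI measurable_completion measurable_lborel2
      measurable_restrict_space1 test_function_continuous[OF assms])

lemma test_function_bounded:
  assumes "\<phi> \<in> test_functions \<Omega>" obtains B where "\<And>x. \<bar>\<phi> x\<bar> \<le> B"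
proof -
  let ?S = "closure {x. \<phi> x \<noteq> 0}"
  have "compact (\<phi> ` ?S)" using assms test_function_continuous[OF assms] 
    by (intro compact_continuous_image) (auto simp: test_functions_def intro: continuous_on_subset)
  then obtain B where B: "\<And>x. x \<in> ?S \<Longrightarrow> norm (\<phi> x) \<le> B"
    using compact_imp_bounded[of "\<phi> ` ?S"] by (auto simp: bounded_iff)
  have "\<bar>\<phi> x\<bar> \<le> \<bar>B\<bar>" for x
    using B[of x] closure_subset[of "{x. \<phi> x \<noteq> 0}"] by (cases "\<phi> x = 0") auto
  with that show thesis by blast
qed

lemma partial_deriv_eq_0:
  assumes "x \<notin> closure {x. \<phi> x \<noteq> 0}" shows "partial_deriv j \<phi> x = 0"
proof -
  have "((\<lambda>x. 0) has_derivative (\<lambda>x. 0)) (at x)" by simp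
  then have "(\<phi> has_derivative (\<lambda>x. 0)) (at x)"
    by (rule has_derivative_transform_within_open[where s="- closure {x. \<phi> x \<noteq> 0}"])
       (use assms closure_subset[of "{x. \<phi> x \<noteq> 0}"] in auto)
  then show ?thesis unfolding partial_deriv_def by (metis frechet_derivative_at)
qed

lemma partial_deriv_test_function:
  assumes "\<phi> \<in> test_functions \<Omega>" shows "partial_deriv j \<phi> \<in> test_functions \<Omega>"
proof -
  have "foldr partial_deriv js (partial_deriv j \<phi>) differentiable_on UNIV" for js
  proof -
    have "foldr partial_deriv (js @ [j]) \<phi> differentiable_on UNIV"
      using assms unfolding test_functions_def by blast
    then show ?thesis by simp
  qed
  moreover have sub: "closure {x. partial_deriv j \<phi> x \<noteq> 0} \<subseteq> closure {x. \<phi> x \<noteq> 0}"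
    using partial_deriv_eq_0 by (intro closure_minimal) blast+
  moreover have "compact (closure {x. partial_deriv j \<phi> x \<noteq> 0})"
    using assms closed_Int_compact[OF closed_closure, of "closure {x. \<phi> x \<noteq> 0}"] sub
    by (metis (mono_tags, lifting) inf.absorb1 mem_Collect_eq test_functions_def)
  ultimately show ?thesis using assms unfolding test_functions_def by auto
qed

lemma test_function_L2:
  assumes "\<Omega> \<in> lmeasurable" "\<phi> \<in> test_functions \<Omega>" shows "\<phi> \<in> L2_space \<Omega>"
  using test_function_bounded[OF assms(2)] test_function_measurable[OF assms(2)]
  by (metis L2_space_bounded assms(1) real_norm_def)

section \<open>Uniqueness and linearity of weak gradients\<close>

lemma weak_gradient_unique:
  assumes \<Omega>: "open \<Omega>" "\<Omega> \<in> lmeasurable"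
    and G: "G \<in> L2_space \<Omega>" "is_weak_gradient \<Omega> w G" "G' \<in> L2_space \<Omega>" "is_weak_gradient \<Omega> w G'"
  shows "AE x in lebesgue_on \<Omega>. G x = G' x"
proof -
  have *: "AE x in lebesgue_on \<Omega>. G x $ i $ j - G' x $ i $ j = 0" for i j
  proof (rule AE_zero_of_test_functions[OF \<Omega>(1)])
    show "integrable (lebesgue_on \<Omega>) (\<lambda>x. G x $ i $ j - G' x $ i $ j)"
      using G \<Omega> by (intro Bochner_Integration.integrable_diff L2_space_integrable L2_space_nth)
    fix \<phi> assume \<phi>: "\<phi> \<in> test_functions \<Omega>"
    have "integrable (lebesgue_on \<Omega>) (\<lambda>x. G x $ i $ j * \<phi> x)" "integrable (lebesgue_on \<Omega>) (\<lambda>x. G' x $ i $ j * \<phi> x)"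
      using L2_inner_integrable[OF L2_space_nth[OF L2_space_nth[OF G(1)]] test_function_L2[OF \<Omega>(2) \<phi>]]
        L2_inner_integrable[OF L2_space_nth[OF L2_space_nth[OF G(3)]] test_function_L2[OF \<Omega>(2) \<phi>]] by auto
    moreover have "integral\<^sup>L (lebesgue_on \<Omega>) (\<lambda>x. G x $ i $ j * \<phi> x) = integral\<^sup>L (lebesgue_on \<Omega>) (\<lambda>x. G' x $ i $ j * \<phi> x)"
      using G(2)[unfolded is_weak_gradient_def, rule_format, OF \<phi>, of i j]
        G(4)[unfolded is_weak_gradient_def, rule_format, OF \<phi>, of i j] by simp
    ultimately show "integral\<^sup>L (lebesgue_on \<Omega>) (\<lambda>x. (G x $ i $ j - G' x $ i $ j) * \<phi> x) = 0"
      by (simp add: left_diff_distrib)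
  qed
  then have "AE x in lebesgue_on \<Omega>. \<forall>i j. G x $ i $ j - G' x $ i $ j = 0"
    by (simp add: AE_all_countable)
  then show ?thesis by eventually_elim (simp add: vec_eq_iff)
qed

lemma weak_gradient_add_scaleR:
  assumes \<Omega>: "\<Omega> \<in> lmeasurable"
    and w: "w \<in> L2_space \<Omega>" "w' \<in> L2_space \<Omega>"
    and G: "G \<in> L2_space \<Omega>" "is_weak_gradient \<Omega> w G" "G' \<in> L2_space \<Omega>" "is_weak_gradient \<Omega> w' G'"
  shows "is_weak_gradient \<Omega> (\<lambda>x. w x + c *\<^sub>R w' x) (\<lambda>x. G x + c *\<^sub>R G' x)"
  unfolding is_weak_gradient_def
proof (intro allI ballI)
  fix i j \<phi> assume \<phi>: "\<phi> \<in> test_functions \<Omega>"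
  note \<phi>2 = test_function_L2[OF \<Omega> \<phi>] test_function_L2[OF \<Omega> partial_deriv_test_function[OF \<phi>]]
  have int: "integrable (lebesgue_on \<Omega>) (\<lambda>x. f x * g x)" if "f \<in> L2_space \<Omega>" "g \<in> L2_space \<Omega>" for f g :: "real^3 \<Rightarrow> real"
    using L2_inner_integrable[OF that] by simp
  note ints = int[OF L2_space_nth[OF w(1)] \<phi>2(2)] int[OF L2_space_nth[OF w(2)] \<phi>2(2)]
    int[OF L2_space_nth[OF L2_space_nth[OF G(1)]] \<phi>2(1)] int[OF L2_space_nth[OF L2_space_nth[OF G(3)]] \<phi>2(1)]
  have "integral\<^sup>L (lebesgue_on \<Omega>) (\<lambda>x. w x $ i * partial_deriv j \<phi> x + c * (w' x $ i * partial_deriv j \<phi> x)) =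
        - integral\<^sup>L (lebesgue_on \<Omega>) (\<lambda>x. G x $ i $ j * \<phi> x + c * (G' x $ i $ j * \<phi> x))"
    using ints G(2,4) \<phi> by (simp add: is_weak_gradient_def)
  then show "integral\<^sup>L (lebesgue_on \<Omega>) (\<lambda>x. (w x + c *\<^sub>R w' x) $ i * partial_deriv j \<phi> x) =
        - integral\<^sup>L (lebesgue_on \<Omega>) (\<lambda>x. (G x + c *\<^sub>R G' x) $ i $ j * \<phi> x)"
    by (simp add: algebra_simps)
qed

lemma grad_weak_gradient:
  assumes "w \<in> H1_space \<Omega>"
  shows "grad \<Omega> w \<in> L2_space \<Omega>" "is_weak_gradient \<Omega> w (grad \<Omega> w)"
proof -
  have "\<exists>G. G \<in> L2_space \<Omega> \<and> is_weak_gradient \<Omega> w G" using assms by (auto simp: H1_space_def)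
  from someI_ex[OF this] show "grad \<Omega> w \<in> L2_space \<Omega>" "is_weak_gradient \<Omega> w (grad \<Omega> w)"
    by (simp_all add: grad_def)
qed

text \<open>The three representatives are chosen independently and match only up to a null set, so
  linearity is stated under the integral, against an arbitrary \<open>F\<close>.\<close>

lemma L2_inner_grad_add_scaleR:
  assumes \<Omega>: "open \<Omega>" "\<Omega> \<in> lmeasurable" and w: "w \<in> H1_space \<Omega>" "w' \<in> H1_space \<Omega>"
    and F: "F \<in> L2_space \<Omega>"
  shows "L2_inner \<Omega> (grad \<Omega> (\<lambda>x. w x + c *\<^sub>R w' x)) F =
    L2_inner \<Omega> (grad \<Omega> w) F + c * L2_inner \<Omega> (grad \<Omega> w') F"
proof -
  let ?G = "\<lambda>x. grad \<Omega> w x + c *\<^sub>R grad \<Omega> w' x"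
  note g = grad_weak_gradient[OF w(1)] grad_weak_gradient[OF w(2)]
  have w2: "w \<in> L2_space \<Omega>" "w' \<in> L2_space \<Omega>" using w by (auto simp: H1_space_def)
  have G2: "?G \<in> L2_space \<Omega>" using g by (intro L2_space_add L2_space_scaleR)
  have wg: "is_weak_gradient \<Omega> (\<lambda>x. w x + c *\<^sub>R w' x) ?G"
    by (intro weak_gradient_add_scaleR \<Omega> w2 g)
  have "(\<lambda>x. w x + c *\<^sub>R w' x) \<in> H1_space \<Omega>"
    using G2 wg w2 unfolding H1_space_def by (auto intro: L2_space_add L2_space_scaleR)
  note h = grad_weak_gradient[OF this]
  have "L2_inner \<Omega> (grad \<Omega> (\<lambda>x. w x + c *\<^sub>R w' x)) F = L2_inner \<Omega> ?G F"
    by (rule L2_inner_cong_AE[OF h(1) G2 F weak_gradient_unique[OF \<Omega> h G2 wg]])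
  then show ?thesis using L2_inner_add_scaleR_left[OF g(1) g(3) F] by simp
qed

section \<open>Piecewise affine functions on a tetrahedral mesh\<close>

text \<open>Moving one point \<open>p\<close> to the origin turns affine into linear independence.
  The data then extend to a linear functional \<open>f\<close>, whose gradient vector is
  \<open>adjoint f 1\<close>.\<close>

lemma affine_interpolation:
  fixes C :: "'a::euclidean_space set" and g :: "'a \<Rightarrow> real"
  assumes "\<not> affine_dependent C"
  shows "\<exists>a b. \<forall>v\<in>C. a \<bullet> v + b = g v"
proof (cases "C = {}")
  case False
  then obtain p S where C: "C = insert p S" "p \<notin> S" by (meson mk_disjoint_insert ex_in_conv)
  let ?B = "(\<lambda>x. - p + x) ` S"
  have "independent ?B" using assms C by (simp add: affine_dependent_iff_dependent)
  from linear_independent_extend[OF this, of "\<lambda>y. g (p + y) - g p"]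
  obtain f where f: "linear f" "\<forall>y\<in>?B. f y = g (p + y) - g p" by blast
  have "f (v - p) = v \<bullet> adjoint f 1 - p \<bullet> adjoint f 1" for v
    using adjoint_works[OF f(1), of "v - p" 1] by (simp add: inner_diff_left)
  moreover have "f (v - p) = g v - g p" if "v \<in> C" for v
    using f that C linear_0[OF f(1)] by force
  ultimately have "\<forall>v\<in>C. adjoint f 1 \<bullet> v + (g p - adjoint f 1 \<bullet> p) = g v"
    by (smt (verit) inner_commute)
  then show ?thesis by blast
qed auto

section \<open>The mesh, interpolation and the nodal basis\<close>

locale tetrahedral_mesh =
  fixes \<Omega> :: "(real^3) set" and \<T> :: "(real^3) set set" and h :: real
  assumes domain: "bounded_lipschitz_domain \<Omega>"
    and mesh: "tetrahedral_triangulation \<Omega> \<T> h"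
begin

lemma domain_facts:
  "open \<Omega>" "\<Omega> \<noteq> {}" "bounded \<Omega>" "\<Omega> \<in> lmeasurable"
  using domain unfolding bounded_lipschitz_domain_def by (auto intro: lmeasurable_open)

lemma finite_mesh: "finite \<T>" and Union_mesh: "\<Union>\<T> = closure \<Omega>"
  using mesh by (auto simp: tetrahedral_triangulation_def triangulation_def)

lemma face_of_Int: "K \<in> \<T> \<Longrightarrow> K' \<in> \<T> \<Longrightarrow> K \<inter> K' face_of K"
  using mesh by (auto simp: tetrahedral_triangulation_def triangulation_def)

lemma compact_closure_domain: "compact (closure \<Omega>)"
  using domain_facts by (simp add: compact_closure)

lemma tetrahedron:
  assumes "K \<in> \<T>"
  shows "\<not> affine_dependent {z. z extreme_point_of K}" "K = convex hull {z. z extreme_point_of K}"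
    "compact K" "convex K" "closed K" "finite {z. z extreme_point_of K}"
proof -
  obtain C where C: "\<not> affine_dependent C" "K = convex hull C"
    using mesh assms by (auto simp: tetrahedral_triangulation_def simplex_def)
  then have eq: "{z. z extreme_point_of K} = C"
    by (simp add: extreme_point_of_convex_hull_affine_independent)
  have fin: "finite C" using C(1) aff_independent_finite by blast
  then show "compact K" using C(2) by (simp add: finite_imp_compact_convex_hull)
  then show "closed K" by (rule compact_imp_closed)
  show "\<not> affine_dependent {z. z extreme_point_of K}" "K = convex hull {z. z extreme_point_of K}"
    "convex K" "finite {z. z extreme_point_of K}"
    unfolding eq using C fin by auto
qed

lemma finite_vertices: "finite (vertices \<T>)"
  unfolding vertices_def using finite_mesh tetrahedron by auto

lemma vertices_subset: "vertices \<T> \<subseteq> \<Union>\<T>"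
  unfolding vertices_def by (auto simp: extreme_point_of_def)

lemma extreme_point_vertex: "K \<in> \<T> \<Longrightarrow> z extreme_point_of K \<Longrightarrow> z \<in> vertices \<T>"
  unfolding vertices_def by auto

text \<open>This is where conformity of the mesh enters. The intersection is a common face, its
  extreme points are vertices of both tetrahedra, and the two affine functions agree there; the face
  being the hull of its extreme points, they agree on all of it.\<close>

lemma affine_eq_on_Int:
  assumes K: "K \<in> \<T>" "K' \<in> \<T>"
    and g: "\<forall>v. v extreme_point_of K \<longrightarrow> a \<bullet> v + b = g v" "\<forall>v. v extreme_point_of K' \<longrightarrow> a' \<bullet> v + b' = g v"
    and x: "x \<in> K" "x \<in> K'"
  shows "a \<bullet> x + b = a' \<bullet> x + b'"
proof -
  let ?F = "K \<inter> K'" and ?E = "{x. (a - a') \<bullet> x = b' - b}"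
  have E: "x \<in> ?E \<longleftrightarrow> a \<bullet> x + b = a' \<bullet> x + b'" for x by (auto simp: inner_diff_left)
  have "?F face_of K" "?F face_of K'" using face_of_Int[OF K] face_of_Int[OF K(2,1)] by (auto simp: Int_commute)
  then have "v extreme_point_of K \<and> v extreme_point_of K'" if "v extreme_point_of ?F" for v
    using that extreme_point_of_face by metis
  then have "{v. v extreme_point_of ?F} \<subseteq> ?E"
    using g by (auto simp: inner_diff_left algebra_simps)
  then have "convex hull {v. v extreme_point_of ?F} \<subseteq> ?E"
    by (intro hull_minimal) (auto intro: convex_hyperplane)
  moreover have "?F = convex hull {v. v extreme_point_of ?F}"
    using tetrahedron[OF K(1)] tetrahedron[OF K(2)]
    by (intro Krein_Milman_Minkowski compact_Int convex_Int) auto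
  ultimately show ?thesis using x E by blast
qed

lemma P1_interpolation: "\<exists>u\<in>P1_space \<T>. \<forall>z\<in>vertices \<T>. u z = g z"
proof -
  have "\<forall>K\<in>\<T>. \<exists>a b. \<forall>v. v extreme_point_of K \<longrightarrow> a \<bullet> v + b = g v"
    using affine_interpolation[OF tetrahedron(1)] by (metis mem_Collect_eq)
  then obtain a b where ab: "\<And>K. K \<in> \<T> \<Longrightarrow> \<forall>v. v extreme_point_of K \<longrightarrow> a K \<bullet> v + b K = g v"
    by metis
  \<comment> \<open>An arbitrary choice among the tetrahedra containing \<open>x\<close>;
    \<open>affine_eq_on_Int\<close> makes the value independent of it, and pasting over finitely
    many closed sets gives continuity.\<close>
  define N where "N x = (SOME K. K \<in> \<T> \<and> x \<in> K)" for x
  define u where "u x = (if x \<in> \<Union>\<T> then a (N x) \<bullet> x + b (N x) else 0)" for x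
  have u: "u x = a K \<bullet> x + b K" if K: "K \<in> \<T>" "x \<in> K" for K x
  proof -
    have "N x \<in> \<T> \<and> x \<in> N x" unfolding N_def by (rule someI_ex) (use K in blast)
    then have N: "N x \<in> \<T>" "x \<in> N x" by auto
    have "a (N x) \<bullet> x + b (N x) = a K \<bullet> x + b K"
      by (rule affine_eq_on_Int[OF N(1) K(1) ab[OF N(1)] ab[OF K(1)] N(2) K(2)])
    then show ?thesis using K by (auto simp: u_def)
  qed
  have "continuous_on (\<Union>K\<in>\<T>. K) u"
  proof (rule continuous_on_closed_Union[OF finite_mesh])
    fix K assume K: "K \<in> \<T>"
    then show "closed K" by (rule tetrahedron)
    have "continuous_on K (\<lambda>x. a K \<bullet> x + b K)" by (intro continuous_intros)
    then show "continuous_on K u" using u[OF K] by (simp cong: continuous_on_cong)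
  qed
  then have "u \<in> P1_space \<T>" using u by (auto simp: P1_space_def u_def[of x for x])
  moreover have "u z = g z" if "z \<in> vertices \<T>" for z
  proof -
    obtain K where K: "K \<in> \<T>" "z extreme_point_of K" using \<open>z \<in> vertices \<T>\<close> by (auto simp: vertices_def)
    then show ?thesis using u[OF K(1), of z] ab[OF K(1)] by (auto simp: extreme_point_of_def)
  qed
  ultimately show ?thesis by blast
qed

lemma P1_space_affine:
  assumes "u \<in> P1_space \<T>" "K \<in> \<T>"
  shows "\<exists>a b. \<forall>x\<in>K. u x = a \<bullet> x + b"
  using assms by (simp add: P1_space_def)

lemma P1_space_add_scaleR:
  assumes "u \<in> P1_space \<T>" "w \<in> P1_space \<T>"
  shows "(\<lambda>x. u x + c * w x) \<in> P1_space \<T>"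
proof -
  have "\<exists>a b. \<forall>x\<in>K. u x + c * w x = a \<bullet> x + b" if K: "K \<in> \<T>" for K
  proof -
    obtain a b where ab: "\<forall>x\<in>K. u x = a \<bullet> x + b"
      using P1_space_affine[OF assms(1) K] by blast
    obtain a' b' where ab': "\<forall>x\<in>K. w x = a' \<bullet> x + b'"
      using P1_space_affine[OF assms(2) K] by blast
    have "\<forall>x\<in>K. u x + c * w x = (a + c *\<^sub>R a') \<bullet> x + (b + c * b')"
      by (simp add: ab ab' inner_add_left distrib_left)
    then show ?thesis by blast
  qed
  moreover have "continuous_on (\<Union>\<T>) (\<lambda>x. u x + c * w x)"
    using assms unfolding P1_space_def by (intro continuous_intros) auto
  moreover have "\<forall>x. x \<notin> \<Union>\<T> \<longrightarrow> u x + c * w x = 0"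
    using assms unfolding P1_space_def by simp
  ultimately show ?thesis unfolding P1_space_def by blast
qed

lemma P1_space_zero: "(\<lambda>x. 0) \<in> P1_space \<T>"
  unfolding P1_space_def by (auto intro!: exI[of _ 0])

lemma P1_space_cmult: "u \<in> P1_space \<T> \<Longrightarrow> (\<lambda>x. u x * c) \<in> P1_space \<T>"
  using P1_space_add_scaleR[OF P1_space_zero, of u c] by (simp add: mult.commute)

lemma P1_space_sum:
  assumes "\<And>i. i \<in> I \<Longrightarrow> u i \<in> P1_space \<T>"
  shows "(\<lambda>x. \<Sum>i\<in>I. u i x) \<in> P1_space \<T>"
  using assms
proof (induction I rule: infinite_finite_induct)
  case (insert i I)
  then show ?case using P1_space_add_scaleR[of "u i" "\<lambda>x. \<Sum>i\<in>I. u i x" 1] by simp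
qed (auto simp: P1_space_zero)

text \<open>A minimum principle: a half-space that contains the vertices of a tetrahedron contains
  their hull. Applied to differences it shows that nodal values determine the function.\<close>

lemma P1_space_nonneg:
  assumes u: "u \<in> P1_space \<T>" and nn: "\<forall>z\<in>vertices \<T>. 0 \<le> u z"
  shows "0 \<le> u x"
proof (cases "x \<in> \<Union>\<T>")
  case True
  then obtain K where K: "K \<in> \<T>" "x \<in> K" by blast
  obtain a b where ab: "\<forall>x\<in>K. u x = a \<bullet> x + b" using P1_space_affine[OF u K(1)] by blast
  have "{z. z extreme_point_of K} \<subseteq> {x. a \<bullet> x \<ge> - b}"
    using nn ab extreme_point_vertex[OF K(1)] by (force simp: extreme_point_of_def)
  then have "convex hull {z. z extreme_point_of K} \<subseteq> {x. a \<bullet> x \<ge> - b}"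
    by (intro hull_minimal) (auto intro: convex_halfspace_ge)
  then have "a \<bullet> x \<ge> - b" using tetrahedron(2)[OF K(1)] K(2) by blast
  then show ?thesis using ab K by simp
next
  case False
  then show ?thesis using u by (simp add: P1_space_def)
qed

lemma P1_space_eqI:
  assumes "u \<in> P1_space \<T>" "w \<in> P1_space \<T>" "\<forall>z\<in>vertices \<T>. u z = w z"
  shows "u = w"
proof
  fix x
  show "u x = w x"
    using P1_space_nonneg[OF P1_space_add_scaleR[OF assms(1,2), of "-1"], of x]
      P1_space_nonneg[OF P1_space_add_scaleR[OF assms(2,1), of "-1"], of x] assms(3) by simp
qed

lemma nodal_basis:
  assumes z: "z \<in> vertices \<T>"
  shows nodal_basis_P1: "nodal_basis \<T> z \<in> P1_space \<T>"
    and nodal_basis_vertex: "\<And>z'. z' \<in> vertices \<T> \<Longrightarrow> nodal_basis \<T> z z' = (if z' = z then 1 else 0)"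
proof -
  have "\<exists>!\<phi>. \<phi> \<in> P1_space \<T> \<and> (\<forall>z'\<in>vertices \<T>. \<phi> z' = (if z' = z then 1 else 0))"
    using P1_interpolation[of "\<lambda>z'. if z' = z then 1 else 0"] P1_space_eqI by (metis (no_types, lifting))
  from theI'[OF this] show "nodal_basis \<T> z \<in> P1_space \<T>"
    "\<And>z'. z' \<in> vertices \<T> \<Longrightarrow> nodal_basis \<T> z z' = (if z' = z then 1 else 0)"
    by (simp_all add: nodal_basis_def)
qed

lemma nodal_basis_nonneg: "z \<in> vertices \<T> \<Longrightarrow> 0 \<le> nodal_basis \<T> z x"
  by (intro P1_space_nonneg nodal_basis_P1) (auto simp: nodal_basis_vertex)

lemma P1_space_expansion:
  assumes "u \<in> P1_space \<T>"
  shows "u x = (\<Sum>z\<in>vertices \<T>. nodal_basis \<T> z x * u z)"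
proof -
  have "u = (\<lambda>x. \<Sum>z\<in>vertices \<T>. nodal_basis \<T> z x * u z)"
    using assms finite_vertices
    by (intro P1_space_eqI P1_space_sum P1_space_cmult nodal_basis_P1)
       (auto simp: nodal_basis_vertex if_distrib[of "\<lambda>x. x * _"] sum.delta cong: if_cong sum.cong)
  then show ?thesis by metis
qed

lemma nodal_basis_sum:
  assumes "x \<in> \<Union>\<T>" shows "(\<Sum>z\<in>vertices \<T>. nodal_basis \<T> z x) = 1"
proof -
  \<comment> \<open>Partition of unity is the nodal expansion of the constant 1, cut off outside the
    mesh as \<open>P1_space\<close> demands.\<close>
  let ?u = "\<lambda>x. if x \<in> \<Union>\<T> then 1 else (0::real)"
  have "continuous_on (\<Union>\<T>) ?u" by (rule continuous_on_eq[of _ "\<lambda>x. 1"]) auto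
  moreover have "\<forall>x\<in>K. ?u x = 0 \<bullet> x + 1" if "K \<in> \<T>" for K using that by auto
  ultimately have "?u \<in> P1_space \<T>" unfolding P1_space_def by fastforce
  from P1_space_expansion[OF this, of x] show ?thesis
    using assms vertices_subset by (simp add: subset_iff cong: sum.cong) 
qed

lemma P1_space3_nth: "w \<in> P1_space3 \<T> \<Longrightarrow> (\<lambda>x. w x $ i) \<in> P1_space \<T>"
  by (simp add: P1_space3_def)

lemma P1_space3_add_scaleR:
  "u \<in> P1_space3 \<T> \<Longrightarrow> w \<in> P1_space3 \<T> \<Longrightarrow> (\<lambda>x. u x + c *\<^sub>R w x) \<in> P1_space3 \<T>"
  by (simp add: P1_space3_def P1_space_add_scaleR)

lemma P1_space3_scaleR_const:
  "u \<in> P1_space \<T> \<Longrightarrow> (\<lambda>x. u x *\<^sub>R e) \<in> P1_space3 \<T>"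
  by (simp add: P1_space3_def P1_space_cmult)

lemma P1_space3_zero: "(\<lambda>x. 0) \<in> P1_space3 \<T>"
  by (simp add: P1_space3_def P1_space_zero)

lemma P1_space3_eqI:
  assumes "u \<in> P1_space3 \<T>" "w \<in> P1_space3 \<T>" "\<forall>z\<in>vertices \<T>. u z = w z"
  shows "u = w"
proof
  fix x
  have "(\<lambda>x. u x $ i) = (\<lambda>x. w x $ i)" for i
    using assms by (intro P1_space_eqI P1_space3_nth) auto
  then show "u x = w x" by (metis vec_eq_iff)
qed

lemma nodal_interpolant_P1: "nodal_interpolant \<T> g \<in> P1_space3 \<T>"
  unfolding P1_space3_def nodal_interpolant_def
  by (auto intro!: P1_space_sum P1_space_cmult nodal_basis_P1)

lemma nodal_interpolant_vertex:
  "z \<in> vertices \<T> \<Longrightarrow> nodal_interpolant \<T> g z = g z"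
  using finite_vertices unfolding nodal_interpolant_def
  by (simp add: nodal_basis_vertex if_distrib[of "\<lambda>x. x *\<^sub>R _"] sum.delta' cong: if_cong sum.cong)

lemma P1_space3_eq_nodal_interpolant:
  assumes "w \<in> P1_space3 \<T>" "\<forall>z\<in>vertices \<T>. w z = g z"
  shows "w = nodal_interpolant \<T> g"
  using assms nodal_interpolant_vertex by (intro P1_space3_eqI nodal_interpolant_P1) auto

section \<open>Integrability of finite element functions and mass lumping\<close>

lemma P1_measurable:
  assumes "u \<in> P1_space \<T>" shows "u \<in> borel_measurable (lebesgue_on \<Omega>)"
proof -
  have "continuous_on \<Omega> u"
    using assms Union_mesh closure_subset[of \<Omega>] by (auto simp: P1_space_def intro: continuous_on_subset)
  then show ?thesis
    using domain_facts by (intro continuous_imp_measurable_on_sets_lebesgue) auto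
qed

lemma P1_bounded:
  assumes "u \<in> P1_space \<T>" obtains B where "\<And>x. \<bar>u x\<bar> \<le> B"
proof -
  have "compact (u ` closure \<Omega>)" using assms Union_mesh compact_closure_domain
    by (intro compact_continuous_image) (auto simp: P1_space_def)
  then obtain B where B: "\<And>x. x \<in> closure \<Omega> \<Longrightarrow> norm (u x) \<le> B"
    using compact_imp_bounded[of "u ` closure \<Omega>"] by (auto simp: bounded_iff)
  have "\<bar>u x\<bar> \<le> \<bar>B\<bar>" for x
    using B[of x] assms Union_mesh by (cases "x \<in> closure \<Omega>") (auto simp: P1_space_def)
  with that show thesis by blast
qed

lemma P1_L2:
  assumes "u \<in> P1_space \<T>" shows "u \<in> L2_space \<Omega>"
proof -
  obtain B where "\<And>x. \<bar>u x\<bar> \<le> B" using P1_bounded[OF assms] by blast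
  then show ?thesis
    by (intro L2_space_bounded[where B=B] domain_facts P1_measurable assms) auto
qed

lemma P1_space3_L2:
  assumes "w \<in> P1_space3 \<T>" shows "w \<in> L2_space \<Omega>"
proof -
  have "(\<lambda>x. (w x $ 1) *\<^sub>R axis 1 1 + ((w x $ 2) *\<^sub>R axis 2 1 + (w x $ 3) *\<^sub>R (axis 3 1 :: real^3))) \<in> L2_space \<Omega>"
    using assms
    by (intro L2_space_add L2_space_bounded_linear[OF P1_L2[OF P1_space3_nth]] bounded_linear_scaleR_left)
  moreover have "(w x $ 1) *\<^sub>R axis 1 1 + ((w x $ 2) *\<^sub>R axis 2 1 + (w x $ 3) *\<^sub>R (axis 3 1 :: real^3)) = w x" for x
    by (auto simp: vec_eq_iff forall_3 axis_def)
  ultimately show ?thesis by simp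
qed

text \<open>By continuity the basis function is positive near \<open>z\<close>. The vertex may lie
  on the boundary, but as a point of the closure it has a nonempty open part of \<Omega> in each of
  its balls, and such a set is not negligible.\<close>

lemma lumped_weight_pos:
  assumes z: "z \<in> vertices \<T>" shows "0 < lumped_weight \<Omega> \<T> z"
proof -
  let ?\<phi> = "nodal_basis \<T> z"
  have int: "integrable (lebesgue_on \<Omega>) ?\<phi>"
    by (intro L2_space_integrable domain_facts P1_L2 nodal_basis_P1 z)
  have nn: "AE x in lebesgue_on \<Omega>. 0 \<le> ?\<phi> x" using nodal_basis_nonneg[OF z] by simp
  have "integral\<^sup>L (lebesgue_on \<Omega>) ?\<phi> \<noteq> 0"
  proof
    assume "integral\<^sup>L (lebesgue_on \<Omega>) ?\<phi> = 0"
    then have "AE x in lebesgue_on \<Omega>. ?\<phi> x = 0"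
      using integral_nonneg_eq_0_iff_AE[OF int nn] by simp
    then have ae: "AE x in lebesgue. x \<in> \<Omega> \<longrightarrow> ?\<phi> x = 0"
      using domain_facts by (simp add: AE_restrict_space_iff)
    have zc: "z \<in> closure \<Omega>" using z vertices_subset Union_mesh by auto
    have "continuous_on (closure \<Omega>) ?\<phi>" using nodal_basis_P1[OF z] Union_mesh by (simp add: P1_space_def)
    then obtain d where d: "d > 0" "\<And>x. x \<in> closure \<Omega> \<Longrightarrow> dist x z < d \<Longrightarrow> dist (?\<phi> x) (?\<phi> z) < 1"
      using zc unfolding continuous_on_iff by (metis zero_less_one)
    have "AE x in lebesgue. x \<notin> ball z d \<inter> \<Omega>"
      using ae
    proof eventually_elim
      case (elim x)
      show ?case
      proof
        assume "x \<in> ball z d \<inter> \<Omega>"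
        then have x: "x \<in> \<Omega>" "x \<in> closure \<Omega>" "dist x z < d"
          using closure_subset[of \<Omega>] by (auto simp: dist_commute)
        then have "dist (?\<phi> x) (?\<phi> z) < 1" using d(2) by blast
        then show False using elim x nodal_basis_vertex[OF z z] by (simp add: dist_real_def)
      qed
    qed
    then have "negligible (ball z d \<inter> \<Omega>)"
      by (simp add: negligible_iff_null_sets AE_iff_null_sets domain_facts open_Int)
    moreover have "open (ball z d \<inter> \<Omega>)" using domain_facts by auto
    moreover have "ball z d \<inter> \<Omega> \<noteq> {}"
    proof -
      obtain y where "y \<in> \<Omega>" "dist y z < d"
        using zc d(1) unfolding closure_approachable by blast
      then have "y \<in> ball z d \<inter> \<Omega>" by (simp add: dist_commute)
      then show ?thesis by blast
    qed
    ultimately show False using open_not_negligible by blast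
  qed
  moreover have "0 \<le> integral\<^sup>L (lebesgue_on \<Omega>) ?\<phi>"
    using nn by (rule integral_nonneg_AE)
  ultimately show ?thesis by (simp add: lumped_weight_def)
qed

lemma lumped_inner_add_scaleR_left:
  "lumped_inner \<Omega> \<T> (\<lambda>x. u x + c *\<^sub>R v x) w = lumped_inner \<Omega> \<T> u w + c * lumped_inner \<Omega> \<T> v w"
  by (simp add: lumped_inner_def inner_add_left algebra_simps sum.distrib sum_distrib_left)

text \<open>No continuity or finite element structure is asked of \<open>u\<close>, so the identity
  applies to the cross products in the velocity equation.\<close>

lemma lumped_inner_nodal_basis:
  assumes z: "z \<in> vertices \<T>"
  shows "lumped_inner \<Omega> \<T> u (\<lambda>x. nodal_basis \<T> z x *\<^sub>R axis i 1) = lumped_weight \<Omega> \<T> z * u z $ i"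
proof -
  have "lumped_inner \<Omega> \<T> u (\<lambda>x. nodal_basis \<T> z x *\<^sub>R axis i 1) =
    (\<Sum>z'\<in>vertices \<T>. if z' = z then lumped_weight \<Omega> \<T> z * u z $ i else 0)"
    unfolding lumped_inner_def using z
    by (intro sum.cong refl) (auto simp: nodal_basis_vertex inner_axis)
  then show ?thesis using z finite_vertices by simp
qed

text \<open>Linearity of \<open>F\<close> is assumed on the finite element space only, since that is
  where it is available for forms built from \<open>grad\<close>. The induction therefore carries
  membership of the partial sums along.\<close>

lemma P1_space3_additive_expansion:
  fixes F :: "(real^3 \<Rightarrow> real^3) \<Rightarrow> real"
  assumes F: "\<And>u w c. u \<in> P1_space3 \<T> \<Longrightarrow> w \<in> P1_space3 \<T> \<Longrightarrow> F (\<lambda>x. u x + c *\<^sub>R w x) = F u + c * F w"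
    and w: "w \<in> P1_space3 \<T>"
  shows "F w = (\<Sum>z\<in>vertices \<T>. \<Sum>i\<in>UNIV. w z $ i * F (\<lambda>x. nodal_basis \<T> z x *\<^sub>R axis i 1))"
proof -
  \<comment> \<open>Adding zero to zero with \<open>c = 1\<close> gives F 0 = F 0 + F 0.\<close>
  have F0: "F (\<lambda>x. 0) = 0" using F[OF P1_space3_zero P1_space3_zero, of 1] by simp
  have sum: "(\<lambda>x. \<Sum>p\<in>S. c p *\<^sub>R b p x) \<in> P1_space3 \<T> \<and> F (\<lambda>x. \<Sum>p\<in>S. c p *\<^sub>R b p x) = (\<Sum>p\<in>S. c p * F (b p))"
    if "finite S" "\<And>p. p \<in> S \<Longrightarrow> b p \<in> P1_space3 \<T>" for S and c :: "(real^3) \<times> 3 \<Rightarrow> real" and b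
    using that
  proof (induction S rule: finite_induct)
    case empty
    then show ?case by (simp add: F0 P1_space3_zero)
  next
    case (insert p S)
    then have "b p \<in> P1_space3 \<T>" "(\<lambda>x. \<Sum>p\<in>S. c p *\<^sub>R b p x) \<in> P1_space3 \<T>"
      "F (\<lambda>x. \<Sum>p\<in>S. c p *\<^sub>R b p x) = (\<Sum>p\<in>S. c p * F (b p))" by auto
    then have "(\<lambda>x. (\<Sum>p\<in>S. c p *\<^sub>R b p x) + c p *\<^sub>R b p x) \<in> P1_space3 \<T>"
      "F (\<lambda>x. (\<Sum>p\<in>S. c p *\<^sub>R b p x) + c p *\<^sub>R b p x) = (\<Sum>p\<in>S. c p * F (b p)) + c p * F (b p)"
      by (simp_all add: F P1_space3_add_scaleR)
    then show ?case using insert by (simp add: add.commute)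
  qed
  let ?S = "Sigma (vertices \<T>) (\<lambda>_. UNIV :: 3 set)"
  let ?b = "\<lambda>p x. nodal_basis \<T> (fst p) x *\<^sub>R (axis (snd p) 1 :: real^3)"
  have b: "?b p \<in> P1_space3 \<T>" if "p \<in> ?S" for p
    using that by (intro P1_space3_scaleR_const nodal_basis_P1) auto
  have s: "(\<lambda>x. \<Sum>p\<in>?S. (w (fst p) $ snd p) *\<^sub>R ?b p x) \<in> P1_space3 \<T>"
    "F (\<lambda>x. \<Sum>p\<in>?S. (w (fst p) $ snd p) *\<^sub>R ?b p x) = (\<Sum>p\<in>?S. (w (fst p) $ snd p) * F (?b p))"
    using sum[of ?S ?b "\<lambda>p. w (fst p) $ snd p"] b finite_vertices by auto
  have "(\<lambda>x. \<Sum>p\<in>?S. (w (fst p) $ snd p) *\<^sub>R ?b p x) = w"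
  proof
    fix x
    have "(\<Sum>p\<in>?S. (w (fst p) $ snd p) *\<^sub>R ?b p x) $ j = w x $ j" for j
    proof -
      have "(\<Sum>p\<in>?S. (w (fst p) $ snd p) *\<^sub>R ?b p x) $ j =
        (\<Sum>z\<in>vertices \<T>. \<Sum>i\<in>UNIV. (if i = j then nodal_basis \<T> z x * w z $ j else 0))"
        unfolding sum.cartesian_product sum_component
        by (intro sum.cong refl) (auto simp: axis_def)
      also have "\<dots> = w x $ j"
        using P1_space_expansion[OF P1_space3_nth[OF w, of j], of x] by simp
      finally show ?thesis .
    qed
    then show "(\<Sum>p\<in>?S. (w (fst p) $ snd p) *\<^sub>R ?b p x) = w x" by (simp add: vec_eq_iff)
  qed
  with s(2) show ?thesis by (simp add: sum.cartesian_product case_prod_beta)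
qed

text \<open>Riesz representation for the lumped product. Its mass matrix is diagonal with positive
  entries, so the nodal values of the representer are explicit quotients. Both definite
  descriptions, the projection and the Laplacian, are resolved by it.\<close>

lemma lumped_representation:
  fixes F :: "(real^3 \<Rightarrow> real^3) \<Rightarrow> real"
  assumes F: "\<And>u w c. u \<in> P1_space3 \<T> \<Longrightarrow> w \<in> P1_space3 \<T> \<Longrightarrow> F (\<lambda>x. u x + c *\<^sub>R w x) = F u + c * F w"
  shows "\<exists>!d. d \<in> P1_space3 \<T> \<and> (\<forall>w\<in>P1_space3 \<T>. lumped_inner \<Omega> \<T> d w = F w)"
proof -
  define d where "d = nodal_interpolant \<T>
    (\<lambda>z. \<chi> i. F (\<lambda>x. nodal_basis \<T> z x *\<^sub>R axis i 1) / lumped_weight \<Omega> \<T> z)"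
  have d: "d \<in> P1_space3 \<T>" unfolding d_def by (rule nodal_interpolant_P1)
  have dF: "lumped_inner \<Omega> \<T> d w = F w" if w: "w \<in> P1_space3 \<T>" for w
  proof -
    have "lumped_inner \<Omega> \<T> d w = (\<Sum>z\<in>vertices \<T>. \<Sum>i\<in>UNIV. w z $ i * F (\<lambda>x. nodal_basis \<T> z x *\<^sub>R axis i 1))"
      unfolding lumped_inner_def
    proof (intro sum.cong refl)
      fix z assume z: "z \<in> vertices \<T>"
      show "lumped_weight \<Omega> \<T> z * (d z \<bullet> w z) =
        (\<Sum>i\<in>UNIV. w z $ i * F (\<lambda>x. nodal_basis \<T> z x *\<^sub>R axis i 1))"
        using lumped_weight_pos[OF z]
        by (simp add: d_def nodal_interpolant_vertex[OF z] inner_vec_def sum_distrib_left mult.commute)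
    qed
    also have "\<dots> = F w" by (rule P1_space3_additive_expansion[symmetric, where F=F]) (auto simp: F w)
    finally show ?thesis .
  qed
  show ?thesis
  proof (intro ex1I conjI ballI)
    fix d' assume d': "d' \<in> P1_space3 \<T> \<and> (\<forall>w\<in>P1_space3 \<T>. lumped_inner \<Omega> \<T> d' w = F w)"
    have "d' z $ i = d z $ i" if z: "z \<in> vertices \<T>" for z i
    proof -
      have "(\<lambda>x. nodal_basis \<T> z x *\<^sub>R axis i 1) \<in> P1_space3 \<T>"
        by (intro P1_space3_scaleR_const nodal_basis_P1 z)
      then have "lumped_weight \<Omega> \<T> z * d' z $ i = lumped_weight \<Omega> \<T> z * d z $ i"
        using d' dF by (simp flip: lumped_inner_nodal_basis[OF z])
      then show ?thesis using lumped_weight_pos[OF z] by simp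
    qed
    then show "d' = d" using d d' by (intro P1_space3_eqI) (auto simp: vec_eq_iff)
  qed (use d dF in auto)
qed

lemma lumped_projection:
  assumes w: "w \<in> L2_space \<Omega>" and wh: "wh \<in> P1_space3 \<T>"
  shows "lumped_inner \<Omega> \<T> (lumped_projection \<Omega> \<T> w) wh = L2_inner \<Omega> w wh"
proof -
  have "\<exists>!p. p \<in> P1_space3 \<T> \<and> (\<forall>wh\<in>P1_space3 \<T>. lumped_inner \<Omega> \<T> p wh = L2_inner \<Omega> w wh)"
    using L2_inner_add_scaleR_left[OF P1_space3_L2 P1_space3_L2 w]
    by (intro lumped_representation) (simp add: L2_inner_commute)
  from theI'[OF this] show ?thesis using wh by (simp add: lumped_projection_def)
qed

text \<open>Jensen's inequality: at each point \<open>w x\<close> is a convex combination of the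
  nodal values, with the nodal basis as weights. The nonnegative weighted variance gives the
  pointwise bound, which is then integrated.\<close>

lemma L2_inner_le_lumped_inner:
  assumes w: "w \<in> P1_space3 \<T>"
  shows "L2_inner \<Omega> w w \<le> lumped_inner \<Omega> \<T> w w"
proof -
  let ?\<phi> = "nodal_basis \<T>"
  have le: "w x \<bullet> w x \<le> (\<Sum>z\<in>vertices \<T>. ?\<phi> z x * (w z \<bullet> w z))" if x: "x \<in> \<Omega>" for x
  proof -
    have wx: "w x = (\<Sum>z\<in>vertices \<T>. ?\<phi> z x *\<^sub>R w z)"
      using P1_space_expansion[OF P1_space3_nth[OF w], of x] by (simp add: vec_eq_iff)
    have "w x \<bullet> w x = (\<Sum>z\<in>vertices \<T>. ?\<phi> z x *\<^sub>R w z) \<bullet> w x" using wx by simp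
    then have wxi: "(\<Sum>z\<in>vertices \<T>. (?\<phi> z x *\<^sub>R w z) \<bullet> w x) = w x \<bullet> w x"
      by (simp only: inner_sum_left)
    have one: "(\<Sum>z\<in>vertices \<T>. ?\<phi> z x) = 1"
      using x Union_mesh closure_subset[of \<Omega>] by (intro nodal_basis_sum) auto
    have "0 \<le> (\<Sum>z\<in>vertices \<T>. ?\<phi> z x * ((w z - w x) \<bullet> (w z - w x)))"
      by (intro sum_nonneg mult_nonneg_nonneg nodal_basis_nonneg inner_ge_zero)
    also have "\<dots> = (\<Sum>z\<in>vertices \<T>. ?\<phi> z x * (w z \<bullet> w z) - 2 * ((?\<phi> z x *\<^sub>R w z) \<bullet> w x) + ?\<phi> z x * (w x \<bullet> w x))"
      by (intro sum.cong refl) (simp add: inner_diff inner_commute algebra_simps)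
    also have "\<dots> = (\<Sum>z\<in>vertices \<T>. ?\<phi> z x * (w z \<bullet> w z)) - 2 * (w x \<bullet> w x) + w x \<bullet> w x"
      by (simp only: sum.distrib sum_subtractf one wxi mult_1 flip: sum_distrib_left sum_distrib_right)
    finally show ?thesis by simp
  qed
  have int: "integrable (lebesgue_on \<Omega>) (?\<phi> z)" if "z \<in> vertices \<T>" for z
    by (intro L2_space_integrable domain_facts P1_L2 nodal_basis_P1 that)
  have "L2_inner \<Omega> w w \<le> integral\<^sup>L (lebesgue_on \<Omega>) (\<lambda>x. \<Sum>z\<in>vertices \<T>. ?\<phi> z x * (w z \<bullet> w z))"
    unfolding L2_inner_def using P1_space3_L2[OF w] le int
    by (intro integral_mono_AE L2_inner_integrable AE_I2 Bochner_Integration.integrable_sum) auto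
  also have "\<dots> = lumped_inner \<Omega> \<T> w w"
    using int by (simp add: lumped_inner_def lumped_weight_def)
  finally show ?thesis .
qed

end

section \<open>Weak gradients of piecewise affine functions\<close>

lemma lborel_integral_translate:
  fixes p :: "'a::euclidean_space \<Rightarrow> real"
  assumes "integrable lborel p"
  shows "integrable lborel (\<lambda>x. p (x + c))" "(LINT x|lborel. p (x + c)) = (LINT x|lborel. p x)"
proof -
  have p: "p \<in> borel_measurable borel" using borel_measurable_integrable[OF assms] by simp
  have "integrable (distr lborel borel ((+) c)) p" using assms by (simp add: lborel_distr_plus)
  then show "integrable lborel (\<lambda>x. p (x + c))"
    using p by (subst (asm) integrable_distr_eq) (auto simp: add.commute)
  have "(LINT x|lborel. p x) = (LINT x|distr lborel borel ((+) c). p x)" by (simp add: lborel_distr_plus)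
  also have "\<dots> = (LINT x|lborel. p (x + c))"
    using p by (subst integral_distr) (auto simp: add.commute)
  finally show "(LINT x|lborel. p (x + c)) = (LINT x|lborel. p x)" by simp
qed

text \<open>
  The integral of a compactly supported function is translation invariant, so its difference
  quotients integrate to zero; dominated convergence passes this on to the derivative.
\<close>

lemma integral_directional_derivative_eq_0:
  fixes p :: "'a::euclidean_space \<Rightarrow> real"
  assumes p: "continuous_on UNIV p" and supp: "compact S" "\<And>x. x \<notin> S \<Longrightarrow> p x = 0"
    and r: "r \<in> borel_measurable borel" and d: "d > 0"
    and lip: "\<And>x t. 0 < t \<Longrightarrow> t < d \<Longrightarrow> x \<in> S \<or> x + t *\<^sub>R e \<in> S \<Longrightarrow> \<bar>p (x + t *\<^sub>R e) - p x\<bar> \<le> C * t"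
    and deriv: "AE x in lborel. ((\<lambda>s. p (x + s *\<^sub>R e)) has_real_derivative r x) (at 0)"
  shows "(LINT x|lborel. r x) = 0"
proof -
  have int_p: "integrable lborel p"
  proof -
    have "integrable lborel (\<lambda>x. indicator S x *\<^sub>R p x)"
      using supp(1) p by (intro borel_integrable_compact) (auto intro: continuous_on_subset)
    moreover have "(\<lambda>x. indicator S x *\<^sub>R p x) = p" using supp(2) by (auto simp: indicator_def fun_eq_iff)
    ultimately show ?thesis by simp
  qed
  \<comment> \<open>Step sizes strictly inside (0, d), where the Lipschitz bound holds, tending to
    zero.\<close>
  define t where "t n = d / 2 * inverse (real (Suc n))" for n
  have t: "0 < t n" "t n < d" for n using d by (auto simp: t_def field_simps add_pos_nonneg intro: add_strict_increasing2)
  have t0: "t \<longlonglongrightarrow> 0" unfolding t_def by (intro tendsto_mult_right_zero LIMSEQ_inverse_real_of_nat)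
  define q where "q n x = (p (x + t n *\<^sub>R e) - p x) / t n" for n x
  obtain R where R: "\<And>x. x \<in> S \<Longrightarrow> norm x \<le> R"
    using compact_imp_bounded[OF supp(1)] by (auto simp: bounded_iff)
  \<comment> \<open>A difference quotient can be nonzero only if \<open>x\<close> or its translate
    lies in \<open>S\<close>; the ball contains all such points for steps below
    \<open>d\<close>.\<close>
  let ?B = "cball (0::'a) (R + d * norm e)"
  have int_q: "(LINT x|lborel. q n x) = 0" "integrable lborel (q n)" for n
    using lborel_integral_translate[OF int_p, of "t n *\<^sub>R e"] int_p by (auto simp: q_def[abs_def])
  have bound: "norm (q n x) \<le> \<bar>C\<bar> * indicator ?B x" for n x
  proof (cases "x \<in> S \<or> x + t n *\<^sub>R e \<in> S")
    case True
    have tn: "norm (t n *\<^sub>R e) \<le> d * norm e" using t[of n] by (simp add: mult_right_mono)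
    have "norm x \<le> R + d * norm e"
      using True
    proof
      assume "x \<in> S"
      then show ?thesis using R[of x] d by (simp add: add_increasing2)
    next
      assume "x + t n *\<^sub>R e \<in> S"
      then show ?thesis using R[of "x + t n *\<^sub>R e"] tn norm_triangle_ineq4[of "x + t n *\<^sub>R e" "t n *\<^sub>R e"] by simp
    qed
    moreover have "norm (q n x) \<le> C"
      using lip[OF t True] t[of n] by (simp add: q_def field_simps abs_mult)
    ultimately show ?thesis by simp
  next
    case False
    then show ?thesis using supp(2) by (simp add: q_def)
  qed
  have lim: "AE x in lborel. (\<lambda>n. q n x) \<longlonglongrightarrow> r x"
    using deriv
  proof eventually_elim
    case (elim x)
    then have "((\<lambda>s. (p (x + s *\<^sub>R e) - p x) / s) \<longlongrightarrow> r x) (at 0)"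
      by (simp add: has_field_derivative_iff)
    moreover have "filterlim t (at 0) sequentially"
      using t0 t(1) by (auto simp: filterlim_at intro!: always_eventually) (metis less_irrefl)
    ultimately show ?case unfolding q_def by (rule filterlim_compose)
  qed
  have "(\<lambda>n. LINT x|lborel. q n x) \<longlonglongrightarrow> (LINT x|lborel. r x)"
  proof (rule integral_dominated_convergence[where w="\<lambda>x. \<bar>C\<bar> * indicator ?B x"])
    have "integrable lborel (indicator ?B :: 'a \<Rightarrow> real)"
      using emeasure_bounded_finite[of ?B] by (intro integrable_real_indicator) auto
    then show "integrable lborel (\<lambda>x. \<bar>C\<bar> * indicator ?B x)" by simp
  qed (use lim bound int_q r in auto)
  then show ?thesis using int_q by (simp add: LIMSEQ_const_iff)
qed

lemma test_function_line_derivative: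
  assumes "\<phi> \<in> test_functions \<Omega>"
  shows "((\<lambda>s. \<phi> (x + s *\<^sub>R axis j 1)) has_real_derivative partial_deriv j \<phi> (x + s *\<^sub>R axis j 1)) (at s)"
proof -
  let ?y = "x + s *\<^sub>R axis j (1::real)"
  let ?D = "frechet_derivative \<phi> (at ?y)"
  have D: "(\<phi> has_derivative ?D) (at ?y)"
    using test_function_differentiable[OF assms] by (simp add: frechet_derivative_works)
  have "((\<lambda>s. x + s *\<^sub>R axis j (1::real)) has_derivative (\<lambda>s. s *\<^sub>R axis j 1)) (at s)"
    by (auto intro!: derivative_eq_intros)
  from has_derivative_compose[OF this D]
  have "((\<lambda>s. \<phi> (x + s *\<^sub>R axis j 1)) has_derivative (\<lambda>h. ?D (h *\<^sub>R axis j 1))) (at s)" .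
  moreover have "?D (h *\<^sub>R axis j 1) = partial_deriv j \<phi> ?y * h" for h
    using linear_cmul[OF has_derivative_linear[OF D]] by (simp add: partial_deriv_def)
  ultimately show ?thesis by (simp add: has_field_derivative_def)
qed

context tetrahedral_mesh
begin

text \<open>The domain need not be convex, so the bound is confined to segments inside its closure.
  The preimages of the tetrahedra under the parametrisation are finitely many closed sets covering
  [0,1], with \<open>u\<close> affine on each; the sum of the norms of all slopes dominates each
  one.\<close>

lemma P1_lipschitz_segment:
  assumes ab: "\<And>K x. K \<in> \<T> \<Longrightarrow> x \<in> K \<Longrightarrow> u x = a K \<bullet> x + b K"
    and seg: "closed_segment x y \<subseteq> closure \<Omega>"
  shows "\<bar>u y - u x\<bar> \<le> (\<Sum>K\<in>\<T>. norm (a K)) * norm (y - x)"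
proof -
  let ?M = "\<Sum>K\<in>\<T>. norm (a K)"
  let ?c = "\<lambda>t. x + t *\<^sub>R (y - x)"
  have "(?M * norm (y - x))-lipschitz_on {0..1} (\<lambda>t. u (?c t))"
  proof (rule lipschitz_on_closed_Union[OF _ _ finite_mesh])
    fix K assume K: "K \<in> \<T>"
    show "closed (?c -` K)"
      using tetrahedron(5)[OF K] by (intro continuous_closed_vimage) (auto intro!: continuous_intros)
    have aM: "norm (a K) \<le> ?M" using K finite_mesh by (intro member_le_sum) auto
    show "(?M * norm (y - x))-lipschitz_on (?c -` K) (\<lambda>t. u (?c t))"
    proof (rule lipschitz_onI)
      fix s t assume "s \<in> ?c -` K" "t \<in> ?c -` K"
      then have "u (?c s) - u (?c t) = (s - t) * (a K \<bullet> (y - x))"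
        using ab[OF K] by (simp add: inner_add_right inner_diff_right algebra_simps)
      then have "dist (u (?c s)) (u (?c t)) = \<bar>s - t\<bar> * \<bar>a K \<bullet> (y - x)\<bar>"
        by (simp add: dist_real_def abs_mult)
      also have "\<dots> \<le> \<bar>s - t\<bar> * (?M * norm (y - x))"
        using Cauchy_Schwarz_ineq2[of "a K" "y - x"] mult_right_mono[OF aM, of "norm (y - x)"]
        by (intro mult_left_mono) auto
      finally show "dist (u (?c s)) (u (?c t)) \<le> ?M * norm (y - x) * dist s t"
        by (simp add: dist_real_def mult.commute)
    qed (simp add: sum_nonneg)
  next
    have "?c t \<in> closed_segment x y" if t: "t \<in> {0..1}" for t
    proof -
      have "?c t = (1 - t) *\<^sub>R x + t *\<^sub>R y" by (simp add: algebra_simps)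
      then show ?thesis using t unfolding closed_segment_def by auto
    qed
    then have "?c t \<in> \<Union>\<T>" if "t \<in> {0..1}" for t
      using that seg unfolding Union_mesh by blast
    then show "{0..1} \<subseteq> (\<Union>K\<in>\<T>. ?c -` K)" by auto
  qed (simp add: sum_nonneg)
  from lipschitz_onD[OF this, of 1 0] show ?thesis by (simp add: dist_real_def)
qed

lemma P1_borel_measurable:
  assumes "u \<in> P1_space \<T>" shows "u \<in> borel_measurable borel"
proof -
  have "(\<lambda>x. indicator (closure \<Omega>) x *\<^sub>R u x) \<in> borel_measurable borel"
    using assms Union_mesh by (intro borel_measurable_continuous_on_indicator) (auto simp: P1_space_def)
  moreover have "(\<lambda>x. indicator (closure \<Omega>) x *\<^sub>R u x) = u"
    using assms Union_mesh by (auto simp: indicator_def P1_space_def fun_eq_iff)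
  ultimately show ?thesis by simp
qed

text \<open>Almost everywhere the derivative of the product of \<open>u\<close> and \<phi> in
  direction \<open>j\<close> is given by the product rule, and its integral vanishes by
  \<open>integral_directional_derivative_eq_0\<close>. Continuity of \<open>u\<close> across faces,
  through the Lipschitz bound, replaces the cancellation of interface terms.\<close>

lemma P1_integration_by_parts:
  assumes u: "u \<in> P1_space \<T>" and ab: "\<And>K x. K \<in> \<T> \<Longrightarrow> x \<in> K \<Longrightarrow> u x = a K \<bullet> x + b K"
    and g: "g \<in> borel_measurable borel" "g \<in> L2_space \<Omega>"
      "\<And>K x. K \<in> \<T> \<Longrightarrow> x \<in> interior K \<Longrightarrow> g x = a K $ j"
    and \<phi>: "\<phi> \<in> test_functions \<Omega>"
  shows "integral\<^sup>L (lebesgue_on \<Omega>) (\<lambda>x. u x * partial_deriv j \<phi> x) =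
    - integral\<^sup>L (lebesgue_on \<Omega>) (\<lambda>x. g x * \<phi> x)"
proof -
  define S where "S = closure {x. \<phi> x \<noteq> 0}"
  define e :: "real^3" where "e = axis j 1"
  let ?d\<phi> = "partial_deriv j \<phi>"
  define r where "r x = u x * ?d\<phi> x + g x * \<phi> x" for x
  note d\<phi> = partial_deriv_test_function[OF \<phi>, of j]
  have S: "compact S" "S \<subseteq> \<Omega>" using \<phi> by (auto simp: S_def test_functions_def)
  have \<phi>0: "\<phi> x = 0" "?d\<phi> x = 0" if "x \<notin> S" for x
    using that closure_subset[of "{x. \<phi> x \<noteq> 0}"] partial_deriv_eq_0[of x \<phi>] by (auto simp: S_def)
  obtain Bu where Bu: "\<And>x. \<bar>u x\<bar> \<le> Bu" using P1_bounded[OF u] by blast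
  obtain B where B: "\<And>x. \<bar>\<phi> x\<bar> \<le> B" using test_function_bounded[OF \<phi>] by blast
  obtain B' where B': "\<And>x. \<bar>?d\<phi> x\<bar> \<le> B'" using test_function_bounded[OF d\<phi>] by blast
  let ?M = "\<Sum>K\<in>\<T>. norm (a K)"
  have u_cont: "continuous_on (closure \<Omega>) u" using u Union_mesh by (simp add: P1_space_def)
  \<comment> \<open>A safety margin: segments shorter than \<open>d\<close> with an endpoint in
    \<open>S\<close> stay inside \<Omega>, away from the jump of \<open>u\<close> to its zero
    extension.\<close>
  obtain d where d: "d > 0" "(\<Union>x\<in>S. ball x d) \<subseteq> \<Omega>"
    using compact_subset_open_imp_ball_epsilon_subset[OF S(1) domain_facts(1) S(2)] by blast
  have rm: "r \<in> borel_measurable borel"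
    using g(1) P1_borel_measurable[OF u] borel_measurable_continuous_onI[OF test_function_continuous[OF \<phi>]]
      borel_measurable_continuous_onI[OF test_function_continuous[OF d\<phi>]]
    unfolding r_def[abs_def] by (intro borel_measurable_add borel_measurable_times)
  have "(LINT x|lborel. r x) = 0"
  proof (rule integral_directional_derivative_eq_0[where p="\<lambda>x. u x * \<phi> x" and S=S and d=d and e=e and C="Bu * B' + B * ?M"])
    \<comment> \<open>Since \<open>u\<close> may jump at the boundary of the domain, continuity is
      pasted from two open sets: \<Omega>, and the complement of the support, where the product
      vanishes.\<close>
    have "continuous_on (\<Omega> \<union> - S) (\<lambda>x. u x * \<phi> x)"
    proof (rule continuous_on_open_Un)
      show "continuous_on \<Omega> (\<lambda>x. u x * \<phi> x)"
        using u_cont closure_subset test_function_continuous[OF \<phi>]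
        by (intro continuous_intros) (auto intro: continuous_on_subset)
      show "continuous_on (- S) (\<lambda>x. u x * \<phi> x)"
        by (rule continuous_on_eq[of _ "\<lambda>x. 0"]) (use \<phi>0 in auto)
    qed (use domain_facts S in \<open>auto intro: compact_imp_closed\<close>)
    moreover have "\<Omega> \<union> - S = UNIV" using S by auto
    ultimately show "continuous_on UNIV (\<lambda>x. u x * \<phi> x)" by simp
    show "u x * \<phi> x = 0" if "x \<notin> S" for x using \<phi>0[OF that] by simp
    show "r \<in> borel_measurable borel" by (rule rm)
  next
    fix x and t :: real
    assume t: "0 < t" "t < d" and x: "x \<in> S \<or> x + t *\<^sub>R e \<in> S"
    let ?y = "x + t *\<^sub>R e"
    have ne: "norm e = 1" by (simp add: e_def)
    have "closed_segment x ?y \<subseteq> \<Omega>"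
    proof
      fix z assume z: "z \<in> closed_segment x ?y"
      have "dist x z \<le> t" "dist ?y z \<le> t"
        using dist_in_closed_segment[OF z] t ne by (auto simp: dist_norm norm_minus_commute)
      then show "z \<in> \<Omega>" using x d(2) t by (force simp: subset_iff)
    qed
    then have "\<bar>u ?y - u x\<bar> \<le> ?M * norm (?y - x)"
      using closure_subset by (intro P1_lipschitz_segment[of u a b] ab) auto
    then have lu: "\<bar>u ?y - u x\<bar> \<le> ?M * t" using ne t by simp
    have "norm (\<phi> (x + t *\<^sub>R axis j 1) - \<phi> (x + 0 *\<^sub>R axis j 1)) \<le> B' * norm (t - 0)"
      by (rule field_differentiable_bound[of UNIV "\<lambda>s. \<phi> (x + s *\<^sub>R axis j 1)"])
         (auto intro: has_field_derivative_at_within test_function_line_derivative[OF \<phi>] B')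
    then have lp: "\<bar>\<phi> ?y - \<phi> x\<bar> \<le> B' * t" using t by (simp add: e_def)
    have "u ?y * \<phi> ?y - u x * \<phi> x = u ?y * (\<phi> ?y - \<phi> x) + \<phi> x * (u ?y - u x)"
      by (simp add: algebra_simps)
    then have "\<bar>u ?y * \<phi> ?y - u x * \<phi> x\<bar> \<le> \<bar>u ?y\<bar> * \<bar>\<phi> ?y - \<phi> x\<bar> + \<bar>\<phi> x\<bar> * \<bar>u ?y - u x\<bar>"
      by (metis abs_mult abs_triangle_ineq)
    also have "\<dots> \<le> Bu * (B' * t) + B * (?M * t)"
      using Bu[of ?y] B[of x] lu lp by (intro add_mono mult_mono) auto
    finally show "\<bar>u ?y * \<phi> ?y - u x * \<phi> x\<bar> \<le> (Bu * B' + B * ?M) * t" by (simp add: algebra_simps)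
  next
    \<comment> \<open>Boundaries of convex sets are negligible, so almost every point of the support
      lies in the interior of a tetrahedron.\<close>
    have "AE x in lebesgue. x \<notin> (\<Union>K\<in>\<T>. frontier K)"
      using finite_mesh tetrahedron(4)
      by (intro AE_not_in) (auto simp: negligible_iff_null_sets[symmetric] intro!: negligible_Union negligible_convex_frontier)
    then have "AE x in lborel. x \<notin> (\<Union>K\<in>\<T>. frontier K)" by (simp add: AE_completion_iff)
    then show "AE x in lborel. ((\<lambda>s. u (x + s *\<^sub>R e) * \<phi> (x + s *\<^sub>R e)) has_real_derivative r x) (at 0)"
    proof eventually_elim
      case (elim x)
      have cont: "continuous_on UNIV (\<lambda>s. x + s *\<^sub>R e)" by (intro continuous_intros)
      show ?case
      proof (cases "x \<in> S")
        case False
        have op: "open ((\<lambda>s. x + s *\<^sub>R e) -` (- S))"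
          using S(1) cont by (intro open_vimage) (auto intro: compact_imp_closed)
        have "((\<lambda>s. 0) has_real_derivative r x) (at 0)" using \<phi>0[OF False] by (simp add: r_def)
        then show ?thesis
          by (rule has_field_derivative_transform_within_open[OF _ op]) (use False \<phi>0 in auto)
      next
        case True
        then obtain K where K: "K \<in> \<T>" "x \<in> K" using S Union_mesh closure_subset by blast
        then have x: "x \<in> interior K" using elim tetrahedron(5)[OF K(1)] by (auto simp: frontier_def)
        have op: "open ((\<lambda>s. x + s *\<^sub>R e) -` interior K)" using cont by (intro open_vimage) auto
        have "((\<lambda>s. a K \<bullet> (x + s *\<^sub>R e) + b K) has_real_derivative a K $ j) (at 0)"
          by (auto intro!: derivative_eq_intros simp: has_field_derivative_def inner_add_right e_def inner_axis)
        from DERIV_mult[OF this test_function_line_derivative[OF \<phi>, of x j 0]]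
        have "((\<lambda>s. (a K \<bullet> (x + s *\<^sub>R e) + b K) * \<phi> (x + s *\<^sub>R e)) has_real_derivative r x) (at 0)"
          using g(3)[OF K(1) x] ab[OF K] by (simp add: r_def e_def mult.commute add.commute)
        then show ?thesis
        proof (rule has_field_derivative_transform_within_open[OF _ op])
          fix s assume "s \<in> (\<lambda>s. x + s *\<^sub>R e) -` interior K"
          then have "x + s *\<^sub>R e \<in> K" using interior_subset by auto
          then show "(a K \<bullet> (x + s *\<^sub>R e) + b K) * \<phi> (x + s *\<^sub>R e) = u (x + s *\<^sub>R e) * \<phi> (x + s *\<^sub>R e)"
            using ab[OF K(1)] by simp
        qed (use x in auto)
      qed
    qed
  qed (use S d in auto)
  moreover have "(LINT x|lborel. r x) = integral\<^sup>L (lebesgue_on \<Omega>) r"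
  proof -
    \<comment> \<open>\<open>r\<close> vanishes off \<open>S\<close>, so integrating over the whole
      space or over \<Omega> makes no difference.\<close>
    have "(\<lambda>x. indicator \<Omega> x *\<^sub>R r x) = r"
    proof
      fix x show "indicator \<Omega> x *\<^sub>R r x = r x"
        using \<phi>0[of x] subsetD[OF S(2), of x] by (cases "x \<in> S") (auto simp: r_def indicator_def)
    qed
    then have "integral\<^sup>L (lebesgue_on \<Omega>) r = (LINT x|lebesgue. r x)"
      using domain_facts by (subst integral_restrict_space) auto
    also have "\<dots> = (LINT x|lborel. r x)" using rm by (intro integral_completion) auto
    finally show ?thesis by simp
  qed
  moreover have "integral\<^sup>L (lebesgue_on \<Omega>) r =
      integral\<^sup>L (lebesgue_on \<Omega>) (\<lambda>x. u x * ?d\<phi> x) + integral\<^sup>L (lebesgue_on \<Omega>) (\<lambda>x. g x * \<phi> x)"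
    using L2_inner_integrable[OF P1_L2[OF u] test_function_L2[OF domain_facts(4) d\<phi>]]
      L2_inner_integrable[OF g(2) test_function_L2[OF domain_facts(4) \<phi>]]
    by (simp add: r_def[abs_def])
  ultimately show ?thesis by simp
qed

text \<open>A face that meets the interior of a convex set is the whole set.\<close>

lemma interior_disjoint:
  assumes "K \<in> \<T>" "K' \<in> \<T>" "x \<in> interior K" "x \<in> interior K'"
  shows "K = K'"
proof -
  have x: "x \<in> K" "x \<in> K'" using assms interior_subset by auto
  have "K \<inter> K' = K" using face_of_disjoint_interior[OF face_of_Int[OF assms(1,2)]] x assms(3) by blast
  moreover have "K' \<inter> K = K'" using face_of_disjoint_interior[OF face_of_Int[OF assms(2,1)]] x assms(4) by blast
  ultimately show ?thesis by blast
qed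

lemma P1_space3_H1:
  assumes w: "w \<in> P1_space3 \<T>" shows "w \<in> H1_space \<Omega>"
proof -
  have "\<forall>K. \<forall>i. \<exists>a b. K \<in> \<T> \<longrightarrow> (\<forall>x\<in>K. w x $ i = a \<bullet> x + b)"
    using P1_space_affine[OF P1_space3_nth[OF w]] by blast
  then obtain a b where ab: "\<And>K i x. K \<in> \<T> \<Longrightarrow> x \<in> K \<Longrightarrow> w x $ i = a K i \<bullet> x + b K i"
    by metis
  define A :: "(real^3) set \<Rightarrow> real^3^3" where "A K = (\<chi> i. a K i)" for K
  \<comment> \<open>Interiors of distinct tetrahedra are disjoint, so at most one summand is
    nonzero; the value 0 on faces concerns a null set.\<close>
  define G where "G x = (\<Sum>K\<in>\<T>. indicator (interior K) x *\<^sub>R A K)" for x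
  have G: "G x = A K" if K: "K \<in> \<T>" "x \<in> interior K" for K x
  proof -
    have "G x = (\<Sum>K'\<in>\<T>. if K' = K then A K else 0)"
      unfolding G_def using K interior_disjoint by (intro sum.cong) (auto simp: indicator_def)
    then show ?thesis using K finite_mesh by simp
  qed
  have Gm: "G \<in> borel_measurable borel"
    unfolding G_def by (intro borel_measurable_sum borel_measurable_scaleR borel_measurable_indicator) auto
  have "norm (G x) \<le> (\<Sum>K\<in>\<T>. norm (A K))" for x
    unfolding G_def by (intro order_trans[OF norm_sum] sum_mono) (auto simp: indicator_def)
  then have G2: "G \<in> L2_space \<Omega>"
    using Gm by (intro L2_space_bounded domain_facts measurable_restrict_space1 measurable_completion) auto
  have "is_weak_gradient \<Omega> w G"
    unfolding is_weak_gradient_def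
  proof (intro allI ballI)
    fix i j \<phi> assume \<phi>: "\<phi> \<in> test_functions \<Omega>"
    show "integral\<^sup>L (lebesgue_on \<Omega>) (\<lambda>x. w x $ i * partial_deriv j \<phi> x) =
        - integral\<^sup>L (lebesgue_on \<Omega>) (\<lambda>x. G x $ i $ j * \<phi> x)"
    proof (rule P1_integration_by_parts[OF P1_space3_nth[OF w] ab _ L2_space_nth[OF L2_space_nth[OF G2]] _ \<phi>])
      have "(\<lambda>M. M $ i $ j) \<in> borel_measurable (borel :: (real^3^3) measure)"
        by (intro borel_measurable_continuous_onI continuous_intros)
      from measurable_compose[OF Gm this] show "(\<lambda>x. G x $ i $ j) \<in> borel_measurable borel" .
    qed (auto simp: G A_def)
  qed
  then show ?thesis using G2 P1_space3_L2[OF w] by (auto simp: H1_space_def)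
qed

end

section \<open>The discrete energy law\<close>

text \<open>\<open>X\<close> and \<open>Y\<close> are orthogonal to \<open>a\<close> and to each
  other, and both have squared length \<open>N\<close>, that of the component of \<open>H\<close>
  orthogonal to \<open>a\<close>; \<open>- Y\<close> is this component. Hence (1 + \<alpha>^2) |v|^2
  = N and (1 + \<alpha>^2) (H . v) = \<alpha> N.\<close>

lemma llg_velocity_pointwise:
  fixes a v H :: "real^3"
  assumes a: "norm a = 1"
    and eq: "(1 + \<alpha>\<^sup>2) *\<^sub>R v = - (a \<times> H) - \<alpha> *\<^sub>R (a \<times> (a \<times> H))"
  shows "a \<bullet> v = 0" "\<alpha> * (v \<bullet> v) = H \<bullet> v"
proof -
  have pos: "1 + \<alpha>\<^sup>2 \<noteq> 0" using zero_le_power2[of \<alpha>] by linarith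
  have aa: "a \<bullet> a = 1" using a by (simp add: norm_eq_1)
  define X where "X = a \<times> H"
  define Y where "Y = a \<times> X"
  define N where "N = H \<bullet> H - (a \<bullet> H)\<^sup>2"
  have eq: "(1 + \<alpha>\<^sup>2) *\<^sub>R v = - X - \<alpha> *\<^sub>R Y" using eq by (simp add: X_def Y_def)
  have Y: "Y = (a \<bullet> H) *\<^sub>R a - H" by (simp add: Y_def X_def Lagrange aa)
  have XY: "a \<bullet> X = 0" "a \<bullet> Y = 0" "H \<bullet> X = 0" "X \<bullet> Y = 0" "Y \<bullet> X = 0"
    by (simp_all add: Y_def X_def dot_cross_self)
  have "X \<bullet> X = N" by (simp add: X_def dot_cross aa N_def power2_eq_square inner_commute)
  moreover have "Y \<bullet> Y = N" "H \<bullet> Y = - N"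
    by (simp_all add: Y N_def inner_diff aa power2_eq_square inner_commute)
  ultimately have XX: "X \<bullet> X = N" "Y \<bullet> Y = N" "H \<bullet> Y = - N" by auto
  have "(1 + \<alpha>\<^sup>2) * (a \<bullet> v) = a \<bullet> ((1 + \<alpha>\<^sup>2) *\<^sub>R v)" by simp
  also have "\<dots> = 0" unfolding eq by (simp add: inner_diff_right XY)
  finally show "a \<bullet> v = 0" using pos by simp
  have "(1 + \<alpha>\<^sup>2) * (H \<bullet> v) = H \<bullet> ((1 + \<alpha>\<^sup>2) *\<^sub>R v)" by simp
  also have "\<dots> = \<alpha> * N" unfolding eq by (simp add: inner_diff_right XY XX)
  finally have H: "(1 + \<alpha>\<^sup>2) * (H \<bullet> v) = \<alpha> * N" .
  have "(1 + \<alpha>\<^sup>2) * ((1 + \<alpha>\<^sup>2) * (v \<bullet> v)) = ((1 + \<alpha>\<^sup>2) *\<^sub>R v) \<bullet> ((1 + \<alpha>\<^sup>2) *\<^sub>R v)" by simp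
  also have "\<dots> = (1 + \<alpha>\<^sup>2) * N"
    unfolding eq by (simp add: inner_diff XY XX power2_eq_square algebra_simps)
  finally have "(1 + \<alpha>\<^sup>2) * (v \<bullet> v) = N" using pos by simp
  with H have "(1 + \<alpha>\<^sup>2) * (\<alpha> * (v \<bullet> v)) = (1 + \<alpha>\<^sup>2) * (H \<bullet> v)" by (simp add: mult.left_commute)
  then show "\<alpha> * (v \<bullet> v) = H \<bullet> v" using pos by simp
qed

context tetrahedral_mesh
begin

lemma grad_L2: "w \<in> P1_space3 \<T> \<Longrightarrow> grad \<Omega> w \<in> L2_space \<Omega>"
  by (intro grad_weak_gradient P1_space3_H1)

lemma stiffness_add_scaleR:
  assumes "u \<in> P1_space3 \<T>" "w \<in> P1_space3 \<T>" "F \<in> L2_space \<Omega>"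
  shows "L2_inner \<Omega> (grad \<Omega> (\<lambda>x. u x + c *\<^sub>R w x)) F = L2_inner \<Omega> (grad \<Omega> u) F + c * L2_inner \<Omega> (grad \<Omega> w) F"
  using assms by (intro L2_inner_grad_add_scaleR domain_facts P1_space3_H1)

lemma discrete_laplacian:
  assumes w: "w \<in> P1_space3 \<T>" and wh: "wh \<in> P1_space3 \<T>"
  shows "lumped_inner \<Omega> \<T> (discrete_laplacian \<Omega> \<T> w) wh = - L2_inner \<Omega> (grad \<Omega> w) (grad \<Omega> wh)"
proof -
  have "\<exists>!d. d \<in> P1_space3 \<T> \<and> (\<forall>wh\<in>P1_space3 \<T>. lumped_inner \<Omega> \<T> d wh = - L2_inner \<Omega> (grad \<Omega> w) (grad \<Omega> wh))"
    using stiffness_add_scaleR[OF _ _ grad_L2[OF w]]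
    by (intro lumped_representation) (simp add: L2_inner_commute[of \<Omega> "grad \<Omega> w"])
  \<comment> \<open>Both sign conventions normalise to the same equation with right-hand side 0,
    which moves the minus sign to where the definition has it.\<close>
  then have "\<exists>!d. d \<in> P1_space3 \<T> \<and> (\<forall>wh\<in>P1_space3 \<T>. - lumped_inner \<Omega> \<T> d wh = L2_inner \<Omega> (grad \<Omega> w) (grad \<Omega> wh))"
    by (simp only: neg_eq_iff_add_eq_0 eq_neg_iff_add_eq_0)
  from theI'[OF this] wh have "- lumped_inner \<Omega> \<T> (discrete_laplacian \<Omega> \<T> w) wh = L2_inner \<Omega> (grad \<Omega> w) (grad \<Omega> wh)"
    by (simp add: discrete_laplacian_def)
  then show ?thesis by simp
qed

text \<open>Testing with \<open>v\<close> produces -k times the mixed term \<open>?S m v\<close>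
  scaled by ell_ex^2, and half the expanded energy of the update produces its opposite, so no
  estimate of the mixed term is needed.\<close>

lemma PC1_IMEX_step:
  fixes \<alpha> \<theta> ell_ex k :: real
  defines "E w \<equiv> L2_inner \<Omega> (grad \<Omega> w) (grad \<Omega> w)"
  assumes m: "m \<in> unit_P1_space3 \<T>" and v: "v \<in> P1_space3 \<T>"
    and m': "m' \<in> unit_P1_space3 \<T>" 
      "\<forall>z\<in>vertices \<T>. m' z = (m z + k *\<^sub>R v z) /\<^sub>R norm (m z + k *\<^sub>R v z)"
    and \<alpha>: "\<alpha> \<ge> 0" and k: "k > 0"
    and g: "(\<lambda>x. \<pi>h m x + g x) \<in> L2_space \<Omega>"
    and H: "H = effective_field \<Omega> \<T> \<theta> ell_ex k \<pi>h g m v"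
    and eq: "\<forall>wh\<in>P1_space3 \<T>. (1 + \<alpha>\<^sup>2) * lumped_inner \<Omega> \<T> v wh =
                - lumped_inner \<Omega> \<T> (\<lambda>x. m x \<times> H x) wh
                - \<alpha> * lumped_inner \<Omega> \<T> (\<lambda>x. m x \<times> (m x \<times> H x)) wh"
    and mesh_condition:
      "\<forall>w\<in>P1_space3 \<T>. (\<forall>z\<in>vertices \<T>. norm (w z) \<ge> 1) \<longrightarrow>
         L2_norm \<Omega> (grad \<Omega> (nodal_interpolant \<T> (\<lambda>z. w z /\<^sub>R norm (w z)))) \<le> L2_norm \<Omega> (grad \<Omega> w)"
  shows "ell_ex\<^sup>2 / 2 * E m' + \<alpha> * k * L2_inner \<Omega> v v + ell_ex\<^sup>2 * (\<theta> - 1/2) * k\<^sup>2 * E v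
    \<le> ell_ex\<^sup>2 / 2 * E m + k * L2_inner \<Omega> v (\<lambda>x. \<pi>h m x + g x)"
proof -
  have mP: "m \<in> P1_space3 \<T>" and m'P: "m' \<in> P1_space3 \<T>" and nm: "\<And>z. z \<in> vertices \<T> \<Longrightarrow> norm (m z) = 1"
    using m m'(1) by (auto simp: unit_P1_space3_def)
  have pt: "m z \<bullet> v z = 0" "\<alpha> * (v z \<bullet> v z) = H z \<bullet> v z" if z: "z \<in> vertices \<T>" for z
  proof -
    \<comment> \<open>The test function is the nodal basis function at \<open>z\<close> times a
      coordinate vector; dividing by the positive weight leaves one component of the nodal
      equation.\<close>
    have "(1 + \<alpha>\<^sup>2) * v z $ i = - (m z \<times> H z) $ i - \<alpha> * (m z \<times> (m z \<times> H z)) $ i" for i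
    proof -
      have "(\<lambda>x. nodal_basis \<T> z x *\<^sub>R axis i 1) \<in> P1_space3 \<T>"
        by (intro P1_space3_scaleR_const nodal_basis_P1 z)
      from eq[rule_format, OF this]
      have "lumped_weight \<Omega> \<T> z * ((1 + \<alpha>\<^sup>2) * v z $ i) =
        lumped_weight \<Omega> \<T> z * (- (m z \<times> H z) $ i - \<alpha> * (m z \<times> (m z \<times> H z)) $ i)"
        unfolding lumped_inner_nodal_basis[OF z] by (simp add: algebra_simps)
      then show ?thesis using lumped_weight_pos[OF z] by simp
    qed
    then have "(1 + \<alpha>\<^sup>2) *\<^sub>R v z = - (m z \<times> H z) - \<alpha> *\<^sub>R (m z \<times> (m z \<times> H z))"
      by (simp add: vec_eq_iff)
    from llg_velocity_pointwise[OF nm[OF z] this] show "m z \<bullet> v z = 0" "\<alpha> * (v z \<bullet> v z) = H z \<bullet> v z" .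
  qed
  let ?S = "\<lambda>u w. L2_inner \<Omega> (grad \<Omega> u) (grad \<Omega> w)"
  let ?F = "L2_inner \<Omega> v (\<lambda>x. \<pi>h m x + g x)"
  have "\<alpha> * lumped_inner \<Omega> \<T> v v = lumped_inner \<Omega> \<T> H v"
    unfolding lumped_inner_def sum_distrib_left
    by (intro sum.cong refl) (simp add: pt(2)[symmetric] mult.left_commute)
  also have "\<dots> = ?F - ell_ex\<^sup>2 * (?S m v + \<theta> * k * E v)"
  proof -
    let ?w = "\<lambda>y. m y + (\<theta> * k) *\<^sub>R v y"
    have wP: "?w \<in> P1_space3 \<T>" by (intro P1_space3_add_scaleR mP v)
    have "H = (\<lambda>x. lumped_projection \<Omega> \<T> (\<lambda>y. \<pi>h m y + g y) x + ell_ex\<^sup>2 *\<^sub>R discrete_laplacian \<Omega> \<T> ?w x)"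
      by (simp add: H effective_field_def fun_eq_iff add.commute)
    then have "lumped_inner \<Omega> \<T> H v = lumped_inner \<Omega> \<T> (lumped_projection \<Omega> \<T> (\<lambda>y. \<pi>h m y + g y)) v
      + ell_ex\<^sup>2 * lumped_inner \<Omega> \<T> (discrete_laplacian \<Omega> \<T> ?w) v"
      by (simp only: lumped_inner_add_scaleR_left)
    also have "\<dots> = ?F - ell_ex\<^sup>2 * ?S ?w v"
      by (simp add: lumped_projection[OF g v] discrete_laplacian[OF wP v] L2_inner_commute)
    also have "?S ?w v = ?S m v + \<theta> * k * E v"
      unfolding E_def by (rule stiffness_add_scaleR[OF mP v grad_L2[OF v]])
    finally show ?thesis .
  qed
  finally have lumped: "\<alpha> * lumped_inner \<Omega> \<T> v v = ?F - ell_ex\<^sup>2 * (?S m v + \<theta> * k * E v)" .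
  \<comment> \<open>The exact L2 norm is below the lumped one, and \<alpha> \<ge> 0 preserves the
    direction, so the damping term may be replaced by the smaller one.\<close>
  have "\<alpha> * L2_inner \<Omega> v v \<le> \<alpha> * lumped_inner \<Omega> \<T> v v"
    by (intro mult_left_mono L2_inner_le_lumped_inner v \<alpha>)
  then have "\<alpha> * L2_inner \<Omega> v v \<le> ?F - ell_ex\<^sup>2 * (?S m v + \<theta> * k * E v)" using lumped by simp
  from mult_left_mono[OF this, of k]
  have damping: "\<alpha> * k * L2_inner \<Omega> v v \<le> k * ?F - ell_ex\<^sup>2 * k * ?S m v - ell_ex\<^sup>2 * \<theta> * k\<^sup>2 * E v"
    using k by (simp add: algebra_simps power2_eq_square)
  have Em': "E m' \<le> E m + 2 * k * ?S m v + k\<^sup>2 * E v"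
  proof -
    let ?w = "\<lambda>y. m y + k *\<^sub>R v y"
    have wP: "?w \<in> P1_space3 \<T>" by (intro P1_space3_add_scaleR mP v)
    have "norm (?w z) \<ge> 1" if z: "z \<in> vertices \<T>" for z
    proof -
      \<comment> \<open>Pythagoras: the velocity is orthogonal to the unit vector
        \<open>m z\<close>, so the update never shortens it, as the mesh condition requires.\<close>
      have "(norm (?w z))\<^sup>2 = 1 + k\<^sup>2 * (norm (v z))\<^sup>2"
        using nm[OF z] pt(1)[OF z]
        by (simp add: power2_norm_eq_inner inner_add inner_commute[of "v z" "m z"] norm_eq_1)
           (simp add: power2_eq_square)
      then have "1\<^sup>2 \<le> (norm (?w z))\<^sup>2" by simp
      then show ?thesis by (rule power2_le_imp_le) simp
    qed
    moreover have "m' = nodal_interpolant \<T> (\<lambda>z. ?w z /\<^sub>R norm (?w z))"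
      using m'P m'(2) by (intro P1_space3_eq_nodal_interpolant) auto
    ultimately have "L2_norm \<Omega> (grad \<Omega> m') \<le> L2_norm \<Omega> (grad \<Omega> ?w)"
      using mesh_condition wP by auto
    moreover have "0 \<le> L2_norm \<Omega> (grad \<Omega> m')"
      unfolding L2_norm_def L2_inner_def by (intro real_sqrt_ge_zero Bochner_Integration.integral_nonneg) simp
    ultimately have "(L2_norm \<Omega> (grad \<Omega> m'))\<^sup>2 \<le> (L2_norm \<Omega> (grad \<Omega> ?w))\<^sup>2" by (intro power_mono)
    then have "E m' \<le> E ?w" by (simp add: L2_norm_power2 E_def)
    also have "E ?w = ?S m ?w + k * ?S v ?w"
      unfolding E_def by (rule stiffness_add_scaleR[OF mP v grad_L2[OF wP]])
    also have "?S m ?w = E m + k * ?S m v"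
      by (subst L2_inner_commute)
         (simp only: stiffness_add_scaleR[OF mP v grad_L2[OF mP]] E_def
           L2_inner_commute[of \<Omega> "grad \<Omega> v" "grad \<Omega> m"])
    also have "?S v ?w = ?S m v + k * E v"
      by (subst L2_inner_commute) (simp only: stiffness_add_scaleR[OF mP v grad_L2[OF v]] E_def)
    finally show ?thesis by (simp add: algebra_simps power2_eq_square)
  qed
  have "ell_ex\<^sup>2 / 2 * E m' \<le> ell_ex\<^sup>2 / 2 * (E m + 2 * k * ?S m v + k\<^sup>2 * E v)"
    using Em' by (intro mult_left_mono) auto
  with damping show ?thesis by (simp add: algebra_simps)
qed

end

section \<open>Summation over the time steps\<close>

theorem theorem3p6:
  fixes \<Omega> :: "(real^3) set" and \<T>\<^sub>h :: "(real^3) set set"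
    and h T k \<alpha> ell_ex \<theta> :: real and L J :: nat
    and f :: "real \<Rightarrow> real^3 \<Rightarrow> real^3"
    and \<pi>\<^sub>h :: "(real^3 \<Rightarrow> real^3) \<Rightarrow> (real^3 \<Rightarrow> real^3)"
    and m v :: "nat \<Rightarrow> real^3 \<Rightarrow> real^3"
  assumes domain: "bounded_lipschitz_domain \<Omega>"
    and mesh: "tetrahedral_triangulation \<Omega> \<T>\<^sub>h h"
    and time: "T > 0" "L > 0" "k = T / real L"
    and damping: "\<alpha> \<ge> 0"
    and exchange_length: "ell_ex > 0"
    and theta: "0 \<le> \<theta>" "\<theta> \<le> 1"
    and applied_field: "C1_L2 T \<Omega> f"
    and lower_order: "L2_operator \<Omega> \<pi>\<^sub>h"
    and mesh_condition:
      "\<forall>w\<in>P1_space3 \<T>\<^sub>h. (\<forall>z\<in>vertices \<T>\<^sub>h. norm (w z) \<ge> 1) \<longrightarrow>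
         L2_norm \<Omega> (grad \<Omega> (nodal_interpolant \<T>\<^sub>h (\<lambda>z. w z /\<^sub>R norm (w z))))
           \<le> L2_norm \<Omega> (grad \<Omega> w)"
    and algorithm: "PC1_IMEX \<Omega> \<T>\<^sub>h \<alpha> \<theta> ell_ex k L \<pi>\<^sub>h f m v"
    and J: "J < L"
  shows
    "ell_ex\<^sup>2 / 2 * (L2_norm \<Omega> (grad \<Omega> (m J)))\<^sup>2
       + \<alpha> * k * (\<Sum>l<J. (L2_norm \<Omega> (v l))\<^sup>2)
       + ell_ex\<^sup>2 * (\<theta> - 1/2) * k\<^sup>2 * (\<Sum>l<J. (L2_norm \<Omega> (grad \<Omega> (v l)))\<^sup>2)
     \<le> ell_ex\<^sup>2 / 2 * (L2_norm \<Omega> (grad \<Omega> (m 0)))\<^sup>2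
       + k * (\<Sum>l<J. L2_inner \<Omega> (v l) (\<lambda>x. \<pi>\<^sub>h (m l) x + f (real l * k) x))"
proof -
  interpret tetrahedral_mesh \<Omega> \<T>\<^sub>h h
    using domain mesh by unfold_locales
  have k: "k > 0" using time by simp
  have m: "m l \<in> unit_P1_space3 \<T>\<^sub>h" if "l \<le> L" for l
    using algorithm that unfolding PC1_IMEX_def by (cases l) (auto simp: Suc_le_eq)
  have step: "ell_ex\<^sup>2 / 2 * (L2_norm \<Omega> (grad \<Omega> (m (Suc l))))\<^sup>2 + \<alpha> * k * (L2_norm \<Omega> (v l))\<^sup>2
      + ell_ex\<^sup>2 * (\<theta> - 1/2) * k\<^sup>2 * (L2_norm \<Omega> (grad \<Omega> (v l)))\<^sup>2
    \<le> ell_ex\<^sup>2 / 2 * (L2_norm \<Omega> (grad \<Omega> (m l)))\<^sup>2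
      + k * L2_inner \<Omega> (v l) (\<lambda>x. \<pi>\<^sub>h (m l) x + f (real l * k) x)" if l: "l < L" for l
  proof -
    \<comment> \<open>The sampling time lies in [0,T], the only range where \<open>C1_L2\<close>
      controls the applied field.\<close>
    have "real l * k \<le> real L * k" using l k by (intro mult_right_mono) auto
    then have "real l * k \<le> T" using time by simp
    then have "real l * k \<in> {0..T}" using k by simp
    then have f: "f (real l * k) \<in> L2_space \<Omega>" using applied_field by (simp add: C1_L2_def)
    have ml: "m l \<in> unit_P1_space3 \<T>\<^sub>h" using m l by simp
    then have "m l \<in> L2_space \<Omega>" by (intro P1_space3_L2) (simp add: unit_P1_space3_def)
    then have field: "(\<lambda>x. \<pi>\<^sub>h (m l) x + f (real l * k) x) \<in> L2_space \<Omega>"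
      using lower_order f by (intro L2_space_add) (auto simp: L2_operator_def)
    have alg: "v l \<in> P1_space3 \<T>\<^sub>h"
      "\<forall>z\<in>vertices \<T>\<^sub>h. m (Suc l) z = (m l z + k *\<^sub>R v l z) /\<^sub>R norm (m l z + k *\<^sub>R v l z)"
      using algorithm l unfolding PC1_IMEX_def by simp_all
    define H where "H = effective_field \<Omega> \<T>\<^sub>h \<theta> ell_ex k \<pi>\<^sub>h (f (real l * k)) (m l) (v l)"
    have eq: "\<forall>wh\<in>P1_space3 \<T>\<^sub>h. (1 + \<alpha>\<^sup>2) * lumped_inner \<Omega> \<T>\<^sub>h (v l) wh =
        - lumped_inner \<Omega> \<T>\<^sub>h (\<lambda>x. m l x \<times> H x) wh
        - \<alpha> * lumped_inner \<Omega> \<T>\<^sub>h (\<lambda>x. m l x \<times> (m l x \<times> H x)) wh"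
      using algorithm l unfolding PC1_IMEX_def Let_def H_def by simp
    show ?thesis
      using PC1_IMEX_step[OF ml alg(1) m[OF Suc_leI[OF l]] alg(2) damping k field H_def eq mesh_condition]
      unfolding L2_norm_power2 .
  qed
  \<comment> \<open>The exchange energies telescope. The bound \<open>J < L\<close> is carried
    through the induction, since step \<open>J\<close> is available only below
    \<open>L\<close>.\<close>
  show ?thesis
    using J
  proof (induction J)
    case 0
    then show ?case by simp
  next
    case (Suc J)
    then show ?case using step[of J] by (simp add: distrib_left)
  qed
qed

end
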